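(* Let $D\ge 1$, $\lambda>0$, $\phi\in(0,\pi/2]$, put $c_1=\frac{\lambda^{-1}}{4}\sin^2\phi$ and $c_2=\lambda^{-1}c_1(1-\cos\phi)$, and let $\Phi\in C^2(\mathbb{R}^D)$ satisfy: (H1) $\Phi(q)\ge 0$ for all $q$ and $\int_{\mathbb{R}^D}|q|^2e^{-\Phi(q)}\,dq<\infty$; (H2) there exist $a>0$ and $b\in(0,1)$ such that $$\tfrac12\langle\nabla\Phi(q),q\rangle\ \ge\ b\,\Phi(q)+\frac{(c_1b)^2+c_2b(1-b)}{2(1-b)}|q|^2-a\qquad\text{for all } q\in\mathbb{R}^D.$$ Let $Z$ be the RHMC process, with $\mathbb{E}_z$ denoting expectation when $Z_0=z$. Then for any $f\in C^\infty_c(\mathbb{R}^{2D})$ and for any $t>0$, $$\int_{\mathbb{R}^{2D}}\mathbb{E}_zf(Z_t)\,\Pi_{\mathrm{BG}}(dz)=\int_{\mathbb{R}^{2D}}f(z)\,\Pi_{\mathrm{BG}}(dz).$$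
   Context: Let $H(q,p)=\frac{|p|^2}{2}+\Phi(q)$ on $\mathbb{R}^{2D}$, and let $\theta_t:\mathbb{R}^{2D}\to\mathbb{R}^{2D}$ be the flow of Hamilton's equations $\dot q=p$, $\dot p=-\nabla\Phi(q)$ (globally defined since $\Phi\ge 0$). Boltzmann–Gibbs measure: $\Pi_{\mathrm{BG}}(dq,dp)=C_0^{-1}(2\pi)^{-D/2}e^{-H(q,p)}\,dq\,dp$ with $C_0=\int_{\mathbb{R}^D}e^{-\Phi(q)}dq$. Momentum randomization: $\Gamma(q,p)=(q,\cos(\phi)p+\sin(\phi)\xi)$ with $\xi\sim\mathcal N(0,1)^D$ a standard $D$-dimensional Gaussian vector. RHMC process $Z_t=(Q_t,P_t)$ with mean duration $\lambda$ and angle $\phi$, started at $Z_0=z$: the càdlàg Markov process with jump times $t_0=0$, $t_{n+1}=t_n+\delta t_n$, where $\delta t_n$ are i.i.d. exponential with mean $\lambda$; for $t_n\le s<t_{n+1}$, $Z_s=\theta_{s-t_n}(Z_{t_n})$, and $Z_{t_{n+1}}=\Gamma(\theta_{\delta t_n}(Z_{t_n}))$, a fresh independent Gaussian vector $\xi$ being used at each jump, all the $\delta t_n$ and Gaussian vectors being mutually independent. $C_c^\infty(\mathbb{R}^{2D})$ is the space of compactly supported smooth functions $\mathbb{R}^{2D}\to\mathbb{R}$. *)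

theory Defs
  imports "HOL-Probability.Probability"
begin

section \<open>Smooth functions and gradients\<close>

text \<open>A function is \<open>C\<^sup>k\<^sup>+\<^sup>1\<close> iff it is differentiable everywhere and all its
  directional derivatives are \<open>C\<^sup>k\<close>.\<close>

primrec C_k :: "nat \<Rightarrow> ('a::euclidean_space \<Rightarrow> real) \<Rightarrow> bool" where
  "C_k 0 f \<longleftrightarrow> continuous_on UNIV f"
| "C_k (Suc k) f \<longleftrightarrow>
     (\<forall>x. f differentiable (at x)) \<and> (\<forall>v. C_k k (\<lambda>x. frechet_derivative f (at x) v))"

definition test_function :: "('a::euclidean_space \<Rightarrow> real) \<Rightarrow> bool" where
  "test_function f \<longleftrightarrow> (\<forall>k. C_k k f) \<and> compact (closure {x. f x \<noteq> 0})"

definition gradient :: "('a::euclidean_space \<Rightarrow> real) \<Rightarrow> 'a \<Rightarrow> 'a" where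
  "gradient f x = (THE D. GDERIV f x :> D)"


section \<open>Hamiltonian dynamics and the Boltzmann--Gibbs measure\<close>

type_synonym 'n phase = "(real ^ 'n) \<times> (real ^ 'n)"

definition hamiltonian :: "(real ^ 'n \<Rightarrow> real) \<Rightarrow> 'n::finite phase \<Rightarrow> real" where
  "hamiltonian \<Phi> = (\<lambda>(q, p). (norm p)\<^sup>2 / 2 + \<Phi> q)"

definition hamiltonian_flow ::
    "(real ^ 'n \<Rightarrow> real) \<Rightarrow> (real \<Rightarrow> 'n::finite phase \<Rightarrow> 'n phase) \<Rightarrow> bool" where
  "hamiltonian_flow \<Phi> \<theta> \<longleftrightarrow>
     (\<forall>z. \<theta> 0 z = z \<and>
        (\<forall>t. ((\<lambda>s. \<theta> s z) has_vector_derivative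
               (snd (\<theta> t z), - gradient \<Phi> (fst (\<theta> t z)))) (at t)))"

definition BG_measure :: "(real ^ 'n \<Rightarrow> real) \<Rightarrow> 'n::finite phase measure" where
  "BG_measure \<Phi> =
     (let C\<^sub>0 = (\<integral>q. exp (- \<Phi> q) \<partial>lborel)
      in density lborel
           (\<lambda>z. ennreal (inverse C\<^sub>0 * (2 * pi) powr (- real CARD('n) / 2)
                          * exp (- hamiltonian \<Phi> z))))"


section \<open>The RHMC process\<close>

definition std_gaussian_density :: "real ^ 'n::finite \<Rightarrow> real" where
  "std_gaussian_density x = (\<Prod>i\<in>UNIV. std_normal_density (x $ i))"

text \<open>\<open>\<delta> n\<close> is the waiting time before jump \<open>n + 1\<close> and \<open>\<xi> n\<close> is the Gaussian vector used at
  that jump. Mutual independence of the two sequences taken together is independence of the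
  generated \<open>\<sigma>\<close>-algebras indexed by a disjoint sum, because \<open>indep_vars\<close> requires all
  variables to have the same type.\<close>

definition rhmc_noise ::
    "'w measure \<Rightarrow> real \<Rightarrow> (nat \<Rightarrow> 'w \<Rightarrow> real) \<Rightarrow> (nat \<Rightarrow> 'w \<Rightarrow> real ^ 'n::finite) \<Rightarrow> bool" where
  "rhmc_noise M lam \<delta> \<xi> \<longleftrightarrow>
     prob_space M \<and>
     (\<forall>n. distributed M lborel (\<delta> n) (exponential_density (1 / lam))) \<and>
     (\<forall>n. distributed M lborel (\<xi> n) std_gaussian_density) \<and>
     prob_space.indep_sets M
       (case_sum (\<lambda>n. {\<delta> n -` A \<inter> space M | A. A \<in> sets borel})
                 (\<lambda>n. {\<xi> n -` A \<inter> space M | A. A \<in> sets borel})) UNIV"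

definition randomize :: "real \<Rightarrow> real ^ 'n \<Rightarrow> 'n::finite phase \<Rightarrow> 'n phase" where
  "randomize \<phi> x = (\<lambda>(q, p). (q, cos \<phi> *\<^sub>R p + sin \<phi> *\<^sub>R x))"

context
  fixes \<theta> :: "real \<Rightarrow> 'n::finite phase \<Rightarrow> 'n phase"
    and \<phi> :: real
    and \<delta> :: "nat \<Rightarrow> 'w \<Rightarrow> real"
    and \<xi> :: "nat \<Rightarrow> 'w \<Rightarrow> real ^ 'n"
begin

definition jump_time :: "nat \<Rightarrow> 'w \<Rightarrow> real" where
  "jump_time n \<omega> = (\<Sum>i<n. \<delta> i \<omega>)"

primrec rhmc_at_jump :: "'n phase \<Rightarrow> nat \<Rightarrow> 'w \<Rightarrow> 'n phase" where
  "rhmc_at_jump z 0 \<omega> = z"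
| "rhmc_at_jump z (Suc n) \<omega> = randomize \<phi> (\<xi> n \<omega>) (\<theta> (\<delta> n \<omega>) (rhmc_at_jump z n \<omega>))"

text \<open>For \<open>s \<ge> 0\<close>, almost surely exactly one \<open>n\<close> satisfies the condition below. On the exceptional null set
  \<open>LEAST\<close>, unlike \<open>THE\<close>, still yields a measurable index.\<close>

definition rhmc :: "'n phase \<Rightarrow> real \<Rightarrow> 'w \<Rightarrow> 'n phase" where
  "rhmc z s \<omega> =
     (let n = (LEAST n. jump_time n \<omega> \<le> s \<and> s < jump_time (Suc n) \<omega>)
      in \<theta> (s - jump_time n \<omega>) (rhmc_at_jump z n \<omega>))"

end

end

theory Submission
  imports Defs
begin

text \<open>The process alternates between running the Hamiltonian flow for a random time and randomizing the
  momentum. Both operations leave the Boltzmann--Gibbs measure invariant, and the random times are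
  independent of the randomizations; averaging over the Gaussian vectors for fixed waiting times, and
  over the waiting times last, gives invariance for the process at time \<open>t\<close>.

  Invariance under the flow is conservation of energy together with Liouville's theorem. The latter is
  obtained without differentiating the flow. The symplectic Euler step is a composition of two shears,
  hence preserves Lebesgue measure, and its iterates converge pointwise to every solution of Hamilton's
  equations (\<open>symplectic_euler_converges\<close>). Fatou's lemma then shows that preimages of open sets
  under the flow have no larger volume than the sets themselves; outer regularity extends this to Borel
  sets, and running time backwards gives equality (\<open>flow_preserves_lborel\<close>). The same convergence
  yields uniqueness of solutions and joint measurability of the flow.

  Invariance under momentum randomization says that \<open>cos \<phi> p + sin \<phi> \<xi>\<close> is a standard Gaussian vector
  when \<open>p\<close> and \<open>\<xi>\<close> are independent ones. It comes from the rotation invariance of Lebesgue measure on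
  pairs of vectors, a rotation being a product of three shears (\<open>rotation_preserves_lborel\<close>).

  The probabilistic part is \<open>rhmc_at_jump_stationary\<close>: by induction on the number of jumps, the state
  after \<open>n\<close> jumps, started from the invariant measure, has that measure as its law and is independent of
  the whole sequence of waiting times. The number of jumps before time \<open>t\<close> and the remaining running
  time are functions of the waiting times, so conditioning on them finishes the proof.\<close>

section \<open>Convergence of the symplectic Euler scheme\<close>

text \<open>One step of the symplectic Euler scheme for \<open>q' = p\<close>, \<open>p' = - g q\<close>. The force is evaluated at
  the updated position; this makes the step a composition of two shears, which the explicit Euler
  step is not.\<close>

definition symplectic_euler :: "('a::real_vector \<Rightarrow> 'a) \<Rightarrow> real \<Rightarrow> 'a \<times> 'a \<Rightarrow> 'a \<times> 'a" where
  "symplectic_euler g h z =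
     (fst z + h *\<^sub>R snd z, snd z - h *\<^sub>R g (fst z + h *\<^sub>R snd z))"

text \<open>Error propagation over one step. Here \<open>(q, p)\<close> and \<open>(q', p')\<close> are points of an exact trajectory
  one step apart, with local truncation error at most \<open>\<bar>h\<bar> * \<epsilon>\<close> in each component, and \<open>(Q, P)\<close>
  approximates the first of them. The force is only locally Lipschitz, so its Lipschitz bound is
  available only once the new position is known to be within distance 1 of the trajectory; the
  smallness hypothesis provides this, because the position error is controlled without any use of
  the force.\<close>

lemma symplectic_euler_error_step:
  fixes q p q' p' Q P :: "'a::real_normed_vector" and g :: "'a \<Rightarrow> 'a"
  assumes h: "\<bar>h\<bar> \<le> 1" and L: "0 \<le> L" and \<epsilon>: "0 \<le> \<epsilon>"
    and q': "norm (q' - q - h *\<^sub>R p) \<le> \<bar>h\<bar> * \<epsilon>"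
    and p': "norm (p' - p + h *\<^sub>R g q') \<le> \<bar>h\<bar> * \<epsilon>"
    and lip: "norm ((Q + h *\<^sub>R P) - q') \<le> 1 \<Longrightarrow>
      norm (g (Q + h *\<^sub>R P) - g q') \<le> L * norm ((Q + h *\<^sub>R P) - q')"
    and small: "(1 + \<bar>h\<bar> * (2 + L)) * (norm (Q - q) + norm (P - p)) + \<bar>h\<bar> * (2 + L) * \<epsilon> \<le> 1"
  shows "norm ((Q + h *\<^sub>R P) - q') + norm ((P - h *\<^sub>R g (Q + h *\<^sub>R P)) - p')
    \<le> (1 + \<bar>h\<bar> * (2 + L)) * (norm (Q - q) + norm (P - p)) + \<bar>h\<bar> * (2 + L) * \<epsilon>"
proof -
  define a b a' b' where "a = norm (Q - q)" and "b = norm (P - p)"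
    and "a' = norm ((Q + h *\<^sub>R P) - q')" and "b' = norm ((P - h *\<^sub>R g (Q + h *\<^sub>R P)) - p')"
  define \<eta> where "\<eta> = \<bar>h\<bar>"
  have pos: "a \<ge> 0" "b \<ge> 0" "a' \<ge> 0" "b' \<ge> 0" "\<eta> \<ge> 0" "\<eta> \<le> 1"
    using h by (auto simp: a_def b_def a'_def b'_def \<eta>_def)
  have "(Q + h *\<^sub>R P) - q' = (Q - q) + h *\<^sub>R (P - p) - (q' - q - h *\<^sub>R p)"
    by (simp add: algebra_simps)
  then have "a' \<le> norm ((Q - q) + h *\<^sub>R (P - p)) + norm (q' - q - h *\<^sub>R p)"
    unfolding a'_def by (metis norm_triangle_ineq4)
  also have "\<dots> \<le> a + \<eta> * b + \<eta> * \<epsilon>"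
    using norm_triangle_ineq[of "Q - q" "h *\<^sub>R (P - p)"] q' by (simp add: a_def b_def \<eta>_def)
  finally have a': "a' \<le> a + \<eta> * b + \<eta> * \<epsilon>" .
  have "0 \<le> \<eta> * (L * a)" "0 \<le> \<eta> * (L * b)" "0 \<le> \<eta> * (L * \<epsilon>)" "0 \<le> \<eta> * \<epsilon>" "0 \<le> \<eta> * a"
    using pos L \<epsilon> by simp_all
  then have "a + \<eta> * b + \<eta> * \<epsilon> \<le> (1 + \<eta> * (2 + L)) * (a + b) + \<eta> * (2 + L) * \<epsilon>"
    using pos by (simp add: algebra_simps)
  with a' small have "a' \<le> 1" by (simp add: a_def b_def \<eta>_def)
  then have lip': "norm (g (Q + h *\<^sub>R P) - g q') \<le> L * a'"
    using lip by (simp add: a'_def)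
  have "(P - h *\<^sub>R g (Q + h *\<^sub>R P)) - p'
      = (P - p) - h *\<^sub>R (g (Q + h *\<^sub>R P) - g q') - (p' - p + h *\<^sub>R g q')"
    by (simp add: algebra_simps)
  then have "b' \<le> norm ((P - p) - h *\<^sub>R (g (Q + h *\<^sub>R P) - g q')) + norm (p' - p + h *\<^sub>R g q')"
    unfolding b'_def by (metis norm_triangle_ineq4)
  also have "\<dots> \<le> b + \<eta> * norm (g (Q + h *\<^sub>R P) - g q') + \<eta> * \<epsilon>"
    using norm_triangle_ineq4[of "P - p" "h *\<^sub>R (g (Q + h *\<^sub>R P) - g q')"] p'
    by (simp add: b_def \<eta>_def)
  also have "\<dots> \<le> b + \<eta> * (L * (a + \<eta> * b + \<eta> * \<epsilon>)) + \<eta> * \<epsilon>"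
    using lip' a' L pos by (intro add_mono mult_left_mono order_trans[OF lip']) auto
  finally have b': "b' \<le> b + \<eta> * (L * (a + \<eta> * b + \<eta> * \<epsilon>)) + \<eta> * \<epsilon>" .
  have "\<eta> * (L * (\<eta> * b + \<eta> * \<epsilon>)) \<le> \<eta> * (L * (b + \<epsilon>))"
    using pos L \<epsilon> by (intro mult_left_mono add_mono mult_left_le_one_le) auto
  then have "a' + b' + (\<eta> * a + \<eta> * a + \<eta> * b)
      \<le> (1 + \<eta> * (2 + L)) * (a + b) + \<eta> * (2 + L) * \<epsilon>"
    using a' b' by (simp add: algebra_simps)
  moreover have "0 \<le> \<eta> * a" "0 \<le> \<eta> * b" using pos by simp_all
  ultimately have "a' + b' \<le> (1 + \<eta> * (2 + L)) * (a + b) + \<eta> * (2 + L) * \<epsilon>"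
    by linarith
  then show ?thesis by (simp add: a_def b_def a'_def b'_def \<eta>_def)
qed

text \<open>The curve \<open>x\<close> need only solve the equation: convergence to every solution starting at \<open>x 0\<close>
  also gives uniqueness of solutions. Uniform continuity of \<open>p\<close> and \<open>g \<circ> q\<close> along the trajectory
  bounds the local errors, and a discrete Gronwall estimate sums them. The same induction keeps the
  scheme within distance 1 of the trajectory, where the force has Lipschitz constant \<open>L\<close>.\<close>

lemma symplectic_euler_converges:
  fixes g :: "'a::euclidean_space \<Rightarrow> 'a" and x :: "real \<Rightarrow> 'a \<times> 'a"
  assumes ode: "\<And>t. (x has_vector_derivative (snd (x t), - g (fst (x t)))) (at t)"
    and lip: "\<And>R. \<exists>L. L-lipschitz_on (cball 0 R) g"
    and cont: "continuous_on UNIV g"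
  shows "(\<lambda>n. (symplectic_euler g (s / real n) ^^ n) (x 0)) \<longlonglongrightarrow> x s"
proof (rule LIMSEQ_I)
  fix r :: real assume "r > 0"
  define q p where "q = (\<lambda>t. fst (x t))" and "p = (\<lambda>t. snd (x t))"
  have dq: "(q has_vector_derivative p t) (at t)" for t
    unfolding q_def p_def using has_derivative_fst[OF ode[of t, unfolded has_vector_derivative_def]]
    by (simp add: has_vector_derivative_def)
  have dp: "(p has_vector_derivative - g (q t)) (at t)" for t
    unfolding q_def p_def using has_derivative_snd[OF ode[of t, unfolded has_vector_derivative_def]]
    by (simp add: has_vector_derivative_def)
  have cq: "continuous_on UNIV q" and cp: "continuous_on UNIV p"
    using dq dp has_vector_derivative_continuous by (blast intro: continuous_at_imp_continuous_on)+
  define S where "S = {-\<bar>s\<bar>..\<bar>s\<bar>}"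
  have S: "compact S" by (simp add: S_def)
  have "compact (q ` S)" by (meson S cq compact_continuous_image continuous_on_subset subset_UNIV)
  then obtain R where R: "\<And>t. t \<in> S \<Longrightarrow> norm (q t) \<le> R"
    using compact_imp_bounded bounded_iff by (metis imageI)
  obtain L where L: "L-lipschitz_on (cball 0 (R + 1)) g" using lip by blast
  have L0: "0 \<le> L" using L lipschitz_on_nonneg by blast
  define C where "C = 2 + L"
  have "C > 0" using L0 by (simp add: C_def)
  \<comment> \<open>Chosen so that the accumulated error \<open>\<epsilon> * (exp (\<bar>s\<bar> * C) - 1)\<close> is below both the target
    accuracy \<open>r\<close> and the radius 1 of the neighbourhood on which \<open>L\<close> is valid.\<close>
  define \<epsilon> where "\<epsilon> = min 1 (r / 2) / exp (\<bar>s\<bar> * C)"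
  have "\<epsilon> > 0" using \<open>r > 0\<close> by (simp add: \<epsilon>_def)
  have e_exp: "\<epsilon> * exp (\<bar>s\<bar> * C) = min 1 (r / 2)" by (simp add: \<epsilon>_def)
  have "uniformly_continuous_on S p"
    by (meson S cp compact_uniformly_continuous continuous_on_subset subset_UNIV)
  then obtain d1 where d1: "d1 > 0" "\<And>u v. u \<in> S \<Longrightarrow> v \<in> S \<Longrightarrow> dist u v < d1 \<Longrightarrow> dist (p u) (p v) < \<epsilon>"
    unfolding uniformly_continuous_on_def using \<open>\<epsilon> > 0\<close> by metis
  have "continuous_on S (\<lambda>t. g (q t))"
    using continuous_on_compose2[OF cont cq] continuous_on_subset by blast
  then have "uniformly_continuous_on S (\<lambda>t. g (q t))"
    using S compact_uniformly_continuous by blast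
  then obtain d2 where d2: "d2 > 0"
      "\<And>u v. u \<in> S \<Longrightarrow> v \<in> S \<Longrightarrow> dist u v < d2 \<Longrightarrow> dist (g (q u)) (g (q v)) < \<epsilon>"
    unfolding uniformly_continuous_on_def using \<open>\<epsilon> > 0\<close> by metis
  define d where "d = min (min d1 d2) 1"
  have "d > 0" using d1 d2 by (simp add: d_def)
  obtain N :: nat where N: "N > \<bar>s\<bar> / d" using reals_Archimedean2 by blast
  show "\<exists>no. \<forall>n\<ge>no. norm ((symplectic_euler g (s / real n) ^^ n) (x 0) - x s) < r"
  proof (intro exI[of _ "Suc N"] allI impI)
    fix n :: nat assume n: "n \<ge> Suc N"
    define h where "h = s / real n"
    have "real n > \<bar>s\<bar> / d" using n N by linarith
    then have hd: "\<bar>h\<bar> < d" using n \<open>d > 0\<close> by (simp add: h_def field_simps)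
    then have h: "\<bar>h\<bar> < d1" "\<bar>h\<bar> < d2" "\<bar>h\<bar> \<le> 1" by (auto simp: d_def)
    have nh: "real n * h = s" using n by (simp add: h_def)
    have kS: "real k * h \<in> S" if "k \<le> n" for k
    proof -
      have "\<bar>real k * h\<bar> \<le> \<bar>real n * h\<bar>" using that by (simp add: abs_mult mult_right_mono)
      then show ?thesis unfolding nh S_def by auto
    qed
    have seg: "closed_segment (real k * h) (real (Suc k) * h) \<subseteq> S" if "Suc k \<le> n" for k
      using kS[of k] kS[of "Suc k"] that unfolding S_def
      by (intro closed_segment_subset) auto
    have close: "dist u v \<le> \<bar>h\<bar>" if "v \<in> {real k * h, real (Suc k) * h}"
        "u \<in> closed_segment (real k * h) (real (Suc k) * h)" for u v k
      using that by (auto simp: closed_segment_eq_real_ivl dist_real_def algebra_simps split: if_splits)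
    define z where "z k = (symplectic_euler g h ^^ k) (x 0)" for k
    have zSuc: "z (Suc k) = symplectic_euler g h (z k)" for k by (simp add: z_def)
    define e where "e k = norm (fst (z k) - q (real k * h)) + norm (snd (z k) - p (real k * h))" for k
    \<comment> \<open>The solution of the error recursion \<open>B (k + 1) = (1 + \<bar>h\<bar> * C) * B k + \<bar>h\<bar> * C * \<epsilon>\<close>
      with \<open>B 0 = 0\<close>.\<close>
    define B where "B k = \<epsilon> * ((1 + \<bar>h\<bar> * C) ^ k - 1)" for k
    have BSuc: "(1 + \<bar>h\<bar> * C) * B k + \<bar>h\<bar> * C * \<epsilon> = B (Suc k)" for k
      by (simp add: B_def algebra_simps)
    have Bn: "B k < min 1 (r / 2)" if "k \<le> n" for k
    proof -
      have "(1 + \<bar>h\<bar> * C) ^ k \<le> exp (\<bar>h\<bar> * C) ^ k"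
        using \<open>C > 0\<close> by (intro power_mono exp_ge_add_one_self) auto
      also have "\<dots> \<le> exp (\<bar>h\<bar> * C) ^ n"
        using that \<open>C > 0\<close> by (intro power_increasing) auto
      also have "\<dots> = exp (\<bar>s\<bar> * C)"
        unfolding exp_of_nat_mult[symmetric] using n by (simp add: h_def)
      finally have "\<epsilon> * ((1 + \<bar>h\<bar> * C) ^ k - 1) < \<epsilon> * exp (\<bar>s\<bar> * C)"
        using \<open>\<epsilon> > 0\<close> by (intro mult_strict_left_mono) auto
      then show ?thesis by (simp add: B_def e_exp)
    qed
    have err: "k \<le> n \<Longrightarrow> e k \<le> B k" for k
    proof (induction k)
      case 0 then show ?case by (simp add: e_def B_def z_def q_def p_def)
    next
      case (Suc k)
      define a b where "a = real k * h" and "b = real (Suc k) * h"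
      have ba: "b - a = h" by (simp add: a_def b_def algebra_simps)
      have abS: "closed_segment a b \<subseteq> S" using seg[OF Suc.prems] by (simp add: a_def b_def)
      have aS: "a \<in> S" and bS: "b \<in> S" using abS by auto
      have cl: "dist u a \<le> \<bar>h\<bar>" "dist u b \<le> \<bar>h\<bar>" if "u \<in> closed_segment a b" for u
        using close[of _ k u] that unfolding a_def b_def by blast+
      have "norm (q b - q a - (b - a) *\<^sub>R p a) \<le> norm (b - a) * \<epsilon>"
      proof (rule vector_differentiable_bound_linearization[of "closed_segment a b"])
        show "(q has_vector_derivative p u) (at u within closed_segment a b)" for u
          using dq has_vector_derivative_at_within by blast
        show "norm (p u - p a) \<le> \<epsilon>" if "u \<in> closed_segment a b" for u
          using d1(2)[of u a] cl[OF that] h aS abS that by (force simp: dist_norm)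
      qed auto
      then have 1: "norm (q b - q a - h *\<^sub>R p a) \<le> \<bar>h\<bar> * \<epsilon>" by (simp add: ba)
      have "norm (p b - p a - (b - a) *\<^sub>R (- g (q b))) \<le> norm (b - a) * \<epsilon>"
      proof (rule vector_differentiable_bound_linearization[of "closed_segment a b"])
        show "(p has_vector_derivative - g (q u)) (at u within closed_segment a b)" for u
          using dp has_vector_derivative_at_within by blast
        show "norm (- g (q u) - - g (q b)) \<le> \<epsilon>" if "u \<in> closed_segment a b" for u
        proof -
          have "dist (g (q u)) (g (q b)) < \<epsilon>"
            using d2(2)[of u b] cl[OF that] h bS abS that by force
          then show ?thesis by (simp add: dist_norm norm_minus_commute)
        qed
      qed auto
      then have 2: "norm (p b - p a + h *\<^sub>R g (q b)) \<le> \<bar>h\<bar> * \<epsilon>" by (simp add: ba)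
      let ?Q = "fst (z k)" and ?P = "snd (z k)"
      have 3: "norm (g (?Q + h *\<^sub>R ?P) - g (q b)) \<le> L * norm (?Q + h *\<^sub>R ?P - q b)"
        if "norm (?Q + h *\<^sub>R ?P - q b) \<le> 1"
      proof -
        have qb: "norm (q b) \<le> R" using R bS by blast
        then have "norm (?Q + h *\<^sub>R ?P) \<le> R + 1"
          using that norm_triangle_sub[of "?Q + h *\<^sub>R ?P" "q b"] by linarith
        then show ?thesis using lipschitz_on_normD[OF L, of "?Q + h *\<^sub>R ?P" "q b"] qb by simp
      qed
      have ek: "e k \<le> B k" using Suc by simp
      have "(1 + \<bar>h\<bar> * C) * e k + \<bar>h\<bar> * C * \<epsilon> \<le> (1 + \<bar>h\<bar> * C) * B k + \<bar>h\<bar> * C * \<epsilon>"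
        using \<open>C > 0\<close> by (intro add_right_mono mult_left_mono ek) auto
      then have 4: "(1 + \<bar>h\<bar> * C) * e k + \<bar>h\<bar> * C * \<epsilon> \<le> B (Suc k)"
        using BSuc by simp
      have 5: "e k = norm (?Q - q a) + norm (?P - p a)" by (simp add: e_def a_def)
      have "e (Suc k) = norm (?Q + h *\<^sub>R ?P - q b) + norm (?P - h *\<^sub>R g (?Q + h *\<^sub>R ?P) - p b)"
        by (simp add: e_def zSuc symplectic_euler_def b_def)
      also have "\<dots> \<le> (1 + \<bar>h\<bar> * (2 + L)) * (norm (?Q - q a) + norm (?P - p a)) + \<bar>h\<bar> * (2 + L) * \<epsilon>"
        using 4 Bn[OF Suc.prems] \<open>\<epsilon> > 0\<close> unfolding C_def 5
        by (intro symplectic_euler_error_step h L0 1 2 3) auto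
      also have "\<dots> \<le> B (Suc k)" using 4 unfolding C_def 5 .
      finally show ?case .
    qed
    have "norm (z n - x s) \<le> norm (fst (z n - x s)) + norm (snd (z n - x s))"
      by (metis norm_Pair_le prod.collapse)
    then have "norm (z n - x s) \<le> e n"
      by (simp add: e_def nh q_def p_def)
    also have "e n < r" using err[of n] Bn[of n] \<open>r > 0\<close> by simp
    finally show "norm ((symplectic_euler g (s / real n) ^^ n) (x 0) - x s) < r"
      by (simp add: z_def h_def)
  qed
qed

section \<open>Measure-preserving maps and shears\<close>

definition preserves_measure :: "'a measure \<Rightarrow> ('a \<Rightarrow> 'a) \<Rightarrow> bool" where
  "preserves_measure M T \<longleftrightarrow> T \<in> measurable M M \<and> distr M M T = M"

lemma preserves_measure_nn_integral:
  assumes "preserves_measure M T" "f \<in> borel_measurable M"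
  shows "(\<integral>\<^sup>+x. f (T x) \<partial>M) = (\<integral>\<^sup>+x. f x \<partial>M)"
  using assms nn_integral_distr[of T M M f] by (simp add: preserves_measure_def)

lemma preserves_measureI:
  assumes "T \<in> measurable M M"
    and "\<And>f. f \<in> borel_measurable M \<Longrightarrow> (\<integral>\<^sup>+x. f (T x) \<partial>M) = (\<integral>\<^sup>+x. f x \<partial>M)"
  shows "preserves_measure M T"
  unfolding preserves_measure_def
proof
  show "distr M M T = M"
  proof (rule measure_eqI)
    fix A assume "A \<in> sets (distr M M T)"
    then have [measurable]: "A \<in> sets M" by simp
    have "emeasure (distr M M T) A = (\<integral>\<^sup>+x. indicator A (T x) \<partial>M)"
      using assms(1) nn_integral_distr[of T M M "indicator A"] by simp
    also have "\<dots> = emeasure M A" using assms(2)[of "indicator A"] by simp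
    finally show "emeasure (distr M M T) A = emeasure M A" .
  qed simp
qed (rule assms(1))

lemma preserves_measure_id: "preserves_measure M (\<lambda>x. x)"
  by (rule preserves_measureI) auto

lemma preserves_measure_comp:
  assumes "preserves_measure M S" "preserves_measure M T"
  shows "preserves_measure M (\<lambda>x. S (T x))"
proof (rule preserves_measureI)
  have [measurable]: "S \<in> measurable M M" "T \<in> measurable M M"
    using assms by (auto simp: preserves_measure_def)
  show "(\<lambda>x. S (T x)) \<in> measurable M M" by measurable
  fix f :: "'a \<Rightarrow> ennreal" assume [measurable]: "f \<in> borel_measurable M"
  show "(\<integral>\<^sup>+x. f (S (T x)) \<partial>M) = (\<integral>\<^sup>+x. f x \<partial>M)"
    using preserves_measure_nn_integral[OF assms(2), of "\<lambda>x. f (S x)"]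
      preserves_measure_nn_integral[OF assms(1), of f] by simp
qed

lemma preserves_measure_funpow:
  assumes "preserves_measure M T" shows "preserves_measure M (T ^^ n)"
proof (induction n)
  case 0 then show ?case using preserves_measure_id by (simp add: id_def)
next
  case (Suc n) then show ?case using preserves_measure_comp[OF assms Suc] by (simp add: comp_def)
qed

lemma preserves_measure_density:
  assumes "preserves_measure M T" and [measurable]: "w \<in> borel_measurable M"
    and "\<And>x. w (T x) = w x"
  shows "preserves_measure (density M w) T"
proof (rule preserves_measureI)
  have [measurable]: "T \<in> measurable M M" using assms by (auto simp: preserves_measure_def)
  show "T \<in> measurable (density M w) (density M w)" by simp
  fix f :: "'a \<Rightarrow> ennreal" assume "f \<in> borel_measurable (density M w)"
  then have [measurable]: "f \<in> borel_measurable M" by simp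
  show "(\<integral>\<^sup>+x. f (T x) \<partial>density M w) = (\<integral>\<^sup>+x. f x \<partial>density M w)"
    using preserves_measure_nn_integral[OF assms(1), of "\<lambda>x. w x * f x"] assms(3)
    by (simp add: nn_integral_density)
qed

lemma nn_integral_lborel_translate:
  fixes f :: "'a::euclidean_space \<Rightarrow> ennreal"
  assumes [measurable]: "f \<in> borel_measurable borel"
  shows "(\<integral>\<^sup>+x. f (x + c) \<partial>lborel) = (\<integral>\<^sup>+x. f x \<partial>lborel)"
  using nn_integral_distr[of "(+) c" lborel borel f] by (simp add: lborel_distr_plus add.commute)

text \<open>On each fibre a shear is a translation, so Fubini and translation invariance suffice. This
  replaces the Jacobian computation, which would ask for a differentiable \<open>u\<close>.\<close>

lemma shear_fst_preserves_lborel: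
  fixes u :: "'b::euclidean_space \<Rightarrow> 'a::euclidean_space"
  assumes [measurable]: "u \<in> borel_measurable borel"
  shows "preserves_measure lborel (\<lambda>z. (fst z + u (snd z), snd z))"
proof (rule preserves_measureI)
  show "(\<lambda>z. (fst z + u (snd z), snd z)) \<in> measurable lborel lborel"
    unfolding measurable_lborel1 measurable_lborel2 borel_prod[symmetric] by measurable
  fix f :: "'a \<times> 'b \<Rightarrow> ennreal" assume "f \<in> borel_measurable lborel"
  then have [measurable]: "f \<in> borel_measurable (borel \<Otimes>\<^sub>M borel)" by (simp add: borel_prod)
  show "(\<integral>\<^sup>+z. f (fst z + u (snd z), snd z) \<partial>lborel) = (\<integral>\<^sup>+z. f z \<partial>lborel)"
    unfolding lborel_prod[symmetric]
    by (subst (1 2) lborel_pair.nn_integral_snd[symmetric])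
       (simp_all add: nn_integral_lborel_translate[of "\<lambda>x. f (x, y)" for y])
qed

lemma shear_snd_preserves_lborel:
  fixes u :: "'a::euclidean_space \<Rightarrow> 'b::euclidean_space"
  assumes [measurable]: "u \<in> borel_measurable borel"
  shows "preserves_measure lborel (\<lambda>z. (fst z, snd z + u (fst z)))"
proof (rule preserves_measureI)
  show "(\<lambda>z. (fst z, snd z + u (fst z))) \<in> measurable lborel lborel"
    unfolding measurable_lborel1 measurable_lborel2 borel_prod[symmetric] by measurable
  fix f :: "'a \<times> 'b \<Rightarrow> ennreal" assume "f \<in> borel_measurable lborel"
  then have [measurable]: "f \<in> borel_measurable (borel \<Otimes>\<^sub>M borel)" by (simp add: borel_prod)
  show "(\<integral>\<^sup>+z. f (fst z, snd z + u (fst z)) \<partial>lborel) = (\<integral>\<^sup>+z. f z \<partial>lborel)"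
    unfolding lborel_prod[symmetric]
    by (subst (1 2) lborel.nn_integral_fst[symmetric])
       (simp_all add: nn_integral_lborel_translate[of "\<lambda>y. f (x, y)" for x])
qed

section \<open>Liouville's theorem\<close>

lemma symplectic_euler_preserves_lborel:
  fixes g :: "'a::euclidean_space \<Rightarrow> 'a"
  assumes [measurable]: "g \<in> borel_measurable borel"
  shows "preserves_measure lborel (symplectic_euler g h)"
proof -
  have "preserves_measure lborel (\<lambda>z::'a\<times>'a.
     (\<lambda>z. (fst z, snd z + - h *\<^sub>R g (fst z))) ((\<lambda>z. (fst z + h *\<^sub>R snd z, snd z)) z))"
    by (rule preserves_measure_comp[OF shear_snd_preserves_lborel shear_fst_preserves_lborel])
      measurable
  then show ?thesis by (simp add: symplectic_euler_def[abs_def])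
qed

text \<open>A global flow of \<open>q' = p\<close>, \<open>p' = - g q\<close>. The group law, measurability and Liouville's theorem are
  derived from the convergence of the symplectic Euler scheme alone, so that the dependence of
  solutions on initial data never has to be differentiated.\<close>

locale newton_flow =
  fixes g :: "'a::euclidean_space \<Rightarrow> 'a" and \<theta> :: "real \<Rightarrow> 'a \<times> 'a \<Rightarrow> 'a \<times> 'a"
  assumes flow_0: "\<theta> 0 z = z"
    and flow_ode: "((\<lambda>s. \<theta> s z) has_vector_derivative (snd (\<theta> t z), - g (fst (\<theta> t z)))) (at t)"
    and force_lipschitz: "\<exists>L. L-lipschitz_on (cball 0 R) g"
    and force_continuous: "continuous_on UNIV g"
begin

lemma symplectic_euler_tendsto_flow:
  "(\<lambda>n. (symplectic_euler g (s / real n) ^^ n) z) \<longlonglongrightarrow> \<theta> s z"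
  using symplectic_euler_converges[of "\<lambda>s. \<theta> s z" g s, OF flow_ode force_lipschitz force_continuous]
  by (simp add: flow_0)

text \<open>Both sides are, as functions of \<open>s\<close>, solutions starting at \<open>\<theta> t z\<close>, hence limits of the same
  Euler scheme.\<close>

lemma flow_add: "\<theta> s (\<theta> t z) = \<theta> (s + t) z"
proof -
  have "((\<lambda>s. \<theta> (s + t) z) has_vector_derivative
      (snd (\<theta> (u + t) z), - g (fst (\<theta> (u + t) z)))) (at u)" for u
  proof -
    have "((\<lambda>s. s + t) has_vector_derivative 1) (at u)"
      by (auto intro!: derivative_eq_intros)
    from vector_diff_chain_at[OF this flow_ode[of z "u + t"]] show ?thesis by (simp add: comp_def)
  qed
  from symplectic_euler_converges[OF this force_lipschitz force_continuous, of s]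
  show ?thesis
    using symplectic_euler_tendsto_flow[of s "\<theta> t z"] by (auto intro: LIMSEQ_unique)
qed

lemma force_measurable [measurable]: "g \<in> borel_measurable borel"
  by (rule borel_measurable_continuous_onI[OF force_continuous])

lemma symplectic_euler_measurable:
  assumes [measurable]: "c \<in> borel_measurable N" "y \<in> measurable N (borel \<Otimes>\<^sub>M borel)"
  shows "(\<lambda>x. symplectic_euler g (c x) (y x)) \<in> measurable N (borel \<Otimes>\<^sub>M borel)"
  unfolding symplectic_euler_def by measurable

text \<open>The flow is a pointwise limit of Euler iterates, which are Borel jointly in time and initial
  point.\<close>

lemma flow_measurable_pair: "(\<lambda>x. \<theta> (fst x) (snd x)) \<in> borel_measurable (borel \<Otimes>\<^sub>M borel)"
proof (rule borel_measurable_LIMSEQ_metric)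
  fix n
  have "(\<lambda>x. (symplectic_euler g (fst x / real n) ^^ k) (snd x))
      \<in> measurable (borel \<Otimes>\<^sub>M borel) (borel \<Otimes>\<^sub>M borel)" for k
  proof (induction k)
    case 0
    show ?case
      using measurable_snd[of "borel :: real measure" "borel :: ('a \<times> 'a) measure"]
      by (simp add: id_def borel_prod)
  next
    case (Suc k) then show ?case by (auto intro!: symplectic_euler_measurable)
  qed
  from this[of n]
  show "(\<lambda>x. (symplectic_euler g (fst x / real n) ^^ n) (snd x)) \<in> borel_measurable (borel \<Otimes>\<^sub>M borel)"
    by (simp add: borel_prod)
qed (rule symplectic_euler_tendsto_flow)

lemma flow_measurable [measurable (raw)]:
  assumes [measurable]: "c \<in> borel_measurable N" "y \<in> borel_measurable N"
  shows "(\<lambda>x. \<theta> (c x) (y x)) \<in> borel_measurable N"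
  using measurable_compose[OF _ flow_measurable_pair, of "\<lambda>x. (c x, y x)" N] by simp

text \<open>One half of Liouville's theorem. If \<open>\<theta> s z\<close> lies in the open set \<open>U\<close>, then so do the Euler
  iterates from some index on. The Euler iterates preserve volume, so Fatou's lemma bounds the
  volume of the preimage of \<open>U\<close>.\<close>

lemma flow_vimage_open_le:
  assumes "open U" shows "emeasure lborel (\<theta> s -` U) \<le> emeasure lborel U"
proof -
  have [measurable]: "U \<in> sets borel" using assms by simp
  let ?E = "\<lambda>n. symplectic_euler g (s / real n) ^^ n"
  have pE: "preserves_measure lborel (?E n)" for n
    by (intro preserves_measure_funpow symplectic_euler_preserves_lborel force_measurable)
  have [measurable]: "?E n \<in> borel_measurable borel" for n
    using pE[of n] by (simp add: preserves_measure_def)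
  have "emeasure lborel (\<theta> s -` U) = (\<integral>\<^sup>+z. indicator (\<theta> s -` U) z \<partial>lborel)"
    using measurable_sets[of "\<theta> s" borel borel U] by simp
  also have "\<dots> \<le> (\<integral>\<^sup>+z. liminf (\<lambda>n. indicator U (?E n z)) \<partial>lborel)"
  proof (intro nn_integral_mono)
    fix z :: "'a \<times> 'a"
    show "indicator (\<theta> s -` U) z \<le> liminf (\<lambda>n. indicator U (?E n z) :: ennreal)"
    proof (cases "\<theta> s z \<in> U")
      case True
      then have "eventually (\<lambda>n. ?E n z \<in> U) sequentially"
        using symplectic_euler_tendsto_flow[of s z] assms topological_tendstoD by blast
      then show ?thesis
        using True by (intro Liminf_bounded) (auto elim: eventually_mono)
    qed auto
  qed
  also have "\<dots> \<le> liminf (\<lambda>n. \<integral>\<^sup>+z. indicator U (?E n z) \<partial>lborel)"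
    by (intro nn_integral_liminf) measurable
  also have "\<dots> = liminf (\<lambda>n. emeasure lborel U)"
    by (subst preserves_measure_nn_integral[OF pE]) auto
  also have "\<dots> = emeasure lborel U" by (simp add: Liminf_const)
  finally show ?thesis .
qed

lemma flow_vimage_le:
  assumes A: "A \<in> sets borel" shows "emeasure lborel (\<theta> s -` A) \<le> emeasure lborel A"
proof (rule ennreal_le_epsilon)
  fix e :: real assume "e > 0"
  obtain U where U: "open U" "A \<subseteq> U" "emeasure lborel (U - A) < e"
    using outer_regular_lborel[OF A \<open>e > 0\<close>] by blast
  have "\<theta> s -` U \<in> sets lborel"
    using measurable_sets[of "\<theta> s" borel borel U] U by simp
  then have "emeasure lborel (\<theta> s -` A) \<le> emeasure lborel (\<theta> s -` U)"
    using U by (intro emeasure_mono) auto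
  also have "\<dots> \<le> emeasure lborel (A \<union> (U - A))"
    using flow_vimage_open_le[OF U(1)] U(2) by (simp add: Un_absorb1)
  also have "\<dots> \<le> emeasure lborel A + emeasure lborel (U - A)"
    using A U by (intro emeasure_subadditive) auto
  also have "\<dots> \<le> emeasure lborel A + ennreal e" using U by (intro add_mono) auto
  finally show "emeasure lborel (\<theta> s -` A) \<le> emeasure lborel A + ennreal e" .
qed

text \<open>Liouville's theorem. The inequality for \<open>\<theta> (- s)\<close>, applied to the preimage of \<open>A\<close> under \<open>\<theta> s\<close>,
  is the inequality reverse to the one for \<open>\<theta> s\<close>.\<close>

theorem flow_preserves_lborel: "preserves_measure lborel (\<theta> s)"
  unfolding preserves_measure_def
proof
  show m: "\<theta> s \<in> measurable lborel lborel" by simp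
  show "distr lborel lborel (\<theta> s) = lborel"
  proof (rule measure_eqI)
    fix A assume "A \<in> sets (distr lborel lborel (\<theta> s))"
    then have A [measurable]: "A \<in> sets borel" by simp
    have "\<theta> s -` A \<in> sets borel" using measurable_sets[of "\<theta> s" borel borel A] by simp
    then have "emeasure lborel (\<theta> (-s) -` \<theta> s -` A) \<le> emeasure lborel (\<theta> s -` A)"
      by (rule flow_vimage_le)
    moreover have "\<theta> (-s) -` \<theta> s -` A = A" by (simp add: vimage_def flow_add flow_0)
    ultimately show "emeasure (distr lborel lborel (\<theta> s)) A = emeasure lborel A"
      using flow_vimage_le[OF A, of s] m by (simp add: emeasure_distr order_antisym)
  qed simp
qed

end

section \<open>Gradients of twice differentiable functions\<close>

lemma gderiv_unique: "GDERIV f x :> D \<Longrightarrow> GDERIV f x :> D' \<Longrightarrow> D = D'"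
  unfolding gderiv_def by (metis has_derivative_unique vector_eq_ldot inner_commute)

lemma differentiable_imp_gderiv:
  fixes f :: "'a::euclidean_space \<Rightarrow> real"
  assumes "f differentiable (at x)"
  shows "GDERIV f x :> (\<Sum>b\<in>Basis. frechet_derivative f (at x) b *\<^sub>R b)"
proof -
  let ?F = "frechet_derivative f (at x)"
  have F: "(f has_derivative ?F) (at x)" using assms frechet_derivative_works by blast
  then have lin: "linear ?F" using has_derivative_linear by blast
  have "?F h = h \<bullet> (\<Sum>b\<in>Basis. ?F b *\<^sub>R b)" for h
  proof -
    have "?F h = ?F (\<Sum>b\<in>Basis. (h \<bullet> b) *\<^sub>R b)" by (simp add: euclidean_representation)
    also have "\<dots> = (\<Sum>b\<in>Basis. (h \<bullet> b) * ?F b)" using lin by (simp add: linear_sum linear_scale)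
    finally show ?thesis by (simp add: inner_sum_right mult.commute)
  qed
  then have "?F = (\<lambda>h. h \<bullet> (\<Sum>b\<in>Basis. ?F b *\<^sub>R b))" by blast
  with F show ?thesis unfolding gderiv_def by simp
qed

text \<open>The gradient is a definite description; this identifies it where the derivative exists and gives
  access to the partial derivatives in which \<open>C_k\<close> is phrased.\<close>

lemma gradient_eq:
  fixes f :: "'a::euclidean_space \<Rightarrow> real"
  assumes "f differentiable (at x)"
  shows "gradient f x = (\<Sum>b\<in>Basis. frechet_derivative f (at x) b *\<^sub>R b)"
  unfolding gradient_def using differentiable_imp_gderiv[OF assms] gderiv_unique by blast

lemma gderiv_gradient:
  fixes f :: "'a::euclidean_space \<Rightarrow> real"
  assumes "f differentiable (at x)"
  shows "GDERIV f x :> gradient f x"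
  using differentiable_imp_gderiv[OF assms] gradient_eq[OF assms] by simp

lemma C1_lipschitz_on_cball:
  fixes u :: "'a::euclidean_space \<Rightarrow> real"
  assumes "C_k 1 u" shows "\<exists>L. L-lipschitz_on (cball 0 R) u"
proof -
  let ?D = "\<lambda>x. frechet_derivative u (at x)"
  have diff: "(u has_derivative ?D x) (at x)" for x
    using assms frechet_derivative_works by auto
  define N where "N x = (\<Sum>b\<in>Basis. norm (?D x b))" for x
  have "continuous_on UNIV (\<lambda>x. ?D x b)" for b using assms by auto
  then have "continuous_on UNIV N" unfolding N_def by (intro continuous_intros) auto
  then have "bounded (N ` cball 0 R)"
    by (meson compact_cball compact_continuous_image compact_imp_bounded continuous_on_subset subset_UNIV)
  then obtain B where B: "\<And>x. x \<in> cball 0 R \<Longrightarrow> norm (N x) \<le> B"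
    unfolding bounded_iff by blast
  have "onorm (?D x) \<le> max 0 B" if "x \<in> cball 0 R" for x
    using onorm_componentwise[OF has_derivative_bounded_linear[OF diff], of x] B[OF that]
    by (simp add: N_def)
  then have "norm (u x - u y) \<le> max 0 B * norm (x - y)" if "x \<in> cball 0 R" "y \<in> cball 0 R" for x y
    using that by (intro differentiable_bound[of "cball 0 R" u ?D] has_derivative_at_withinI[OF diff]) auto
  then show ?thesis by (intro exI[of _ "max 0 B"] lipschitz_onI) (auto simp: dist_norm)
qed

text \<open>The partial derivatives of a \<open>C\<^sup>2\<close> function are \<open>C\<^sup>1\<close>, hence Lipschitz on balls, which are convex
  and compact.\<close>

lemma C2_gradient_lipschitz_on_cball:
  fixes f :: "'a::euclidean_space \<Rightarrow> real"
  assumes "C_k 2 f" shows "\<exists>L. L-lipschitz_on (cball 0 R) (gradient f)"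
proof -
  let ?u = "\<lambda>b x. frechet_derivative f (at x) b"
  have diff: "f differentiable (at x)" for x using assms by (simp add: numeral_2_eq_2)
  have "\<forall>b. \<exists>L. L-lipschitz_on (cball 0 R) (?u b)"
    using assms by (intro allI C1_lipschitz_on_cball) (simp add: numeral_2_eq_2)
  then obtain L where L: "\<And>b. (L b)-lipschitz_on (cball 0 R) (?u b)" by metis
  have "norm (gradient f x - gradient f y) \<le> (\<Sum>b\<in>Basis. L b) * norm (x - y)"
    if "x \<in> cball 0 R" "y \<in> cball 0 R" for x y
  proof -
    have "norm (gradient f x - gradient f y) \<le> (\<Sum>b\<in>Basis. \<bar>(gradient f x - gradient f y) \<bullet> b\<bar>)"
      by (rule norm_le_l1)
    also have "\<dots> = (\<Sum>b\<in>Basis. \<bar>?u b x - ?u b y\<bar>)"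
      by (simp add: gradient_eq[OF diff] inner_diff_left)
    also have "\<dots> \<le> (\<Sum>b\<in>Basis. L b * norm (x - y))"
      using lipschitz_on_normD[OF L that] by (intro sum_mono) auto
    finally show ?thesis by (simp add: sum_distrib_right)
  qed
  moreover have "0 \<le> (\<Sum>b\<in>Basis. L b)" using L lipschitz_on_nonneg by (intro sum_nonneg) blast
  ultimately show ?thesis
    by (intro exI[of _ "\<Sum>b\<in>Basis. L b"] lipschitz_onI) (auto simp: dist_norm)
qed

lemma C2_gradient_continuous:
  fixes f :: "'a::euclidean_space \<Rightarrow> real"
  assumes "C_k 2 f" shows "continuous_on UNIV (gradient f)"
proof -
  have diff: "f differentiable (at x)" for x using assms by (simp add: numeral_2_eq_2)
  have "continuous_on UNIV (\<lambda>x. frechet_derivative f (at x) b)" for b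
    using assms
    by (intro continuous_at_imp_continuous_on ballI differentiable_imp_continuous_within)
      (simp add: numeral_2_eq_2)
  then show ?thesis
    unfolding gradient_eq[OF diff, abs_def] by (intro continuous_intros) auto
qed

section \<open>Invariance of the Boltzmann--Gibbs measure under the flow\<close>

lemma hamiltonian_flow_newton_flow:
  fixes \<Phi> :: "real ^ 'n::finite \<Rightarrow> real"
  assumes "C_k 2 \<Phi>" "hamiltonian_flow \<Phi> \<theta>"
  shows "newton_flow (gradient \<Phi>) \<theta>"
  using assms C2_gradient_lipschitz_on_cball C2_gradient_continuous
  by unfold_locales (auto simp: hamiltonian_flow_def)

lemma hamiltonian_conserved:
  fixes \<Phi> :: "real ^ 'n::finite \<Rightarrow> real"
  assumes diff: "\<And>q. \<Phi> differentiable (at q)" and flow: "hamiltonian_flow \<Phi> \<theta>"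
  shows "hamiltonian \<Phi> (\<theta> t z) = hamiltonian \<Phi> z"
proof -
  have "((\<lambda>s. hamiltonian \<Phi> (\<theta> s z)) has_real_derivative 0) (at s)" for s
  proof -
    define q p where "q = fst (\<theta> s z)" and "p = snd (\<theta> s z)"
    have ode: "((\<lambda>s. \<theta> s z) has_derivative (\<lambda>h. h *\<^sub>R (p, - gradient \<Phi> q))) (at s)"
      using flow unfolding hamiltonian_flow_def has_vector_derivative_def q_def p_def by blast
    have dq: "((\<lambda>s. fst (\<theta> s z)) has_derivative (\<lambda>h. h *\<^sub>R p)) (at s)"
      using has_derivative_fst[OF ode] by simp
    have dp: "((\<lambda>s. snd (\<theta> s z)) has_derivative (\<lambda>h. h *\<^sub>R (- gradient \<Phi> q))) (at s)"
      using has_derivative_snd[OF ode] by simp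
    have d\<Phi>: "(\<Phi> has_derivative (\<lambda>h. h \<bullet> gradient \<Phi> q)) (at (fst (\<theta> s z)))"
      using gderiv_gradient[OF diff, of q] by (simp add: gderiv_def q_def)
    have 1: "((\<lambda>s. \<Phi> (fst (\<theta> s z))) has_derivative (\<lambda>h. (h *\<^sub>R p) \<bullet> gradient \<Phi> q)) (at s)"
      by (rule has_derivative_compose[OF dq d\<Phi>])
    have 2: "((\<lambda>s. (norm (snd (\<theta> s z)))\<^sup>2 / 2) has_derivative
        (\<lambda>h. (h *\<^sub>R (- gradient \<Phi> q)) \<bullet> p)) (at s)"
      unfolding power2_norm_eq_inner
      by (rule has_derivative_eq_rhs[OF has_derivative_divide'[OF has_derivative_inner[OF dp dp]]])
        (auto simp: fun_eq_iff p_def inner_commute field_simps)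
    have "((\<lambda>s. (norm (snd (\<theta> s z)))\<^sup>2 / 2 + \<Phi> (fst (\<theta> s z))) has_derivative (\<lambda>h. 0 * h)) (at s)"
      by (rule has_derivative_eq_rhs[OF has_derivative_add[OF 2 1]])
        (auto simp: fun_eq_iff inner_commute)
    then show ?thesis
      unfolding has_field_derivative_def hamiltonian_def case_prod_beta .
  qed
  moreover have "\<theta> 0 z = z" using flow unfolding hamiltonian_flow_def by blast
  ultimately show ?thesis
    using DERIV_isconst_all[of "\<lambda>s. hamiltonian \<Phi> (\<theta> s z)" t 0] by simp
qed

lemma potential_continuous:
  assumes "C_k 2 \<Phi>" shows "continuous_on UNIV \<Phi>"
  using assms
  by (intro continuous_at_imp_continuous_on ballI differentiable_imp_continuous_within)
    (simp add: numeral_2_eq_2)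

lemma hamiltonian_measurable:
  fixes \<Phi> :: "real ^ 'n::finite \<Rightarrow> real"
  assumes [measurable]: "\<Phi> \<in> borel_measurable borel"
  shows "hamiltonian \<Phi> \<in> borel_measurable borel"
  unfolding hamiltonian_def case_prod_beta borel_prod[symmetric] by measurable

lemma sets_BG_measure [measurable_cong, simp]: "sets (BG_measure \<Phi>) = sets borel"
  by (simp add: BG_measure_def Let_def)

lemma space_BG_measure [simp]: "space (BG_measure \<Phi>) = UNIV"
  by (simp add: BG_measure_def Let_def)

text \<open>The density of the Boltzmann--Gibbs measure is a function of the energy, which the flow conserves,
  and the flow preserves Lebesgue measure.\<close>

lemma flow_preserves_BG_measure:
  fixes \<Phi> :: "real ^ 'n::finite \<Rightarrow> real"
  assumes C2: "C_k 2 \<Phi>" and flow: "hamiltonian_flow \<Phi> \<theta>"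
  shows "preserves_measure (BG_measure \<Phi>) (\<theta> s)"
proof -
  interpret newton_flow "gradient \<Phi>" \<theta> by (rule hamiltonian_flow_newton_flow[OF C2 flow])
  have [measurable]: "hamiltonian \<Phi> \<in> borel_measurable borel"
    using potential_continuous[OF C2]
    by (intro hamiltonian_measurable borel_measurable_continuous_onI)
  have "\<And>q. \<Phi> differentiable (at q)" using C2 by (simp add: numeral_2_eq_2)
  then show ?thesis
    unfolding BG_measure_def Let_def
    by (intro preserves_measure_density flow_preserves_lborel)
      (simp_all add: hamiltonian_conserved[OF _ flow])
qed

section \<open>Invariance under momentum randomization\<close>

lemma std_gaussian_density_eq:
  fixes x :: "real ^ 'n::finite"
  shows "std_gaussian_density x = (2 * pi) powr (- real CARD('n) / 2) * exp (- (norm x)\<^sup>2 / 2)"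
proof -
  have "std_gaussian_density x = (\<Prod>i\<in>UNIV. (2 * pi) powr (- 1 / 2) * exp (- (x $ i)\<^sup>2 / 2))"
    unfolding std_gaussian_density_def
    by (intro prod.cong) (auto simp: std_normal_density_def powr_minus powr_half_sqrt divide_simps)
  also have "\<dots> = ((2 * pi) powr (- 1 / 2)) ^ CARD('n) * exp (\<Sum>i\<in>UNIV. - (x $ i)\<^sup>2 / 2)"
    by (simp add: prod.distrib exp_sum)
  also have "(\<Sum>i\<in>UNIV. - (x $ i)\<^sup>2 / 2) = - (norm x)\<^sup>2 / 2"
    by (simp add: norm_vec_def L2_set_def sum_nonneg sum_negf flip: sum_divide_distrib)
  also have "((2 * pi) powr (- 1 / 2)) ^ CARD('n) = (2 * pi) powr (- real CARD('n) / 2)"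
    by (simp add: powr_power)
  finally show ?thesis .
qed

lemma std_gaussian_density_measurable [measurable]: "std_gaussian_density \<in> borel_measurable borel"
  unfolding std_gaussian_density_eq[abs_def] by measurable

text \<open>A plane rotation by an angle \<open>\<alpha>\<close> with \<open>sin \<alpha> \<noteq> 0\<close> is a product of three shears, with parameters
  \<open>tan (\<alpha> / 2)\<close>, \<open>- sin \<alpha>\<close> and \<open>tan (\<alpha> / 2)\<close>. Applied to pairs of vectors, this turns
  invariance of Lebesgue measure under the rotation into invariance under shears.\<close>

lemma rotation_preserves_lborel:
  assumes "c\<^sup>2 + s\<^sup>2 = 1" "s \<noteq> 0"
  shows "preserves_measure lborel
    (\<lambda>z::'a::euclidean_space \<times> 'a. (c *\<^sub>R fst z + s *\<^sub>R snd z, c *\<^sub>R snd z - s *\<^sub>R fst z))"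
proof -
  \<comment> \<open>\<open>\<tau> = tan (\<alpha> / 2)\<close> when \<open>c = cos \<alpha>\<close> and \<open>s = sin \<alpha>\<close>.\<close>
  define \<tau> where "\<tau> = (1 - c) / s"
  have \<tau>s: "\<tau> * s = 1 - c" using assms(2) by (simp add: \<tau>_def)
  have "(1 - c) * (1 + c) = s * s"
    using assms(1) by (simp add: algebra_simps power2_eq_square)
  then have \<tau>c: "\<tau> * (1 + c) = s" using assms(2) by (simp add: \<tau>_def)
  let ?S = "\<lambda>z::'a\<times>'a. (fst z + \<tau> *\<^sub>R snd z, snd z)"
  let ?T = "\<lambda>z::'a\<times>'a. (fst z, snd z + (- s) *\<^sub>R fst z)"
  have S: "preserves_measure lborel ?S" by (rule shear_fst_preserves_lborel) measurable
  have T: "preserves_measure lborel ?T" by (rule shear_snd_preserves_lborel) measurable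
  have pres: "preserves_measure lborel (\<lambda>z. ?S (?T (?S z)))"
    by (rule preserves_measure_comp[OF S preserves_measure_comp[OF T S]])
  have eq: "(\<lambda>z. ?S (?T (?S z)))
      = (\<lambda>z. (c *\<^sub>R fst z + s *\<^sub>R snd z, c *\<^sub>R snd z - s *\<^sub>R fst z))"
  proof
    fix z :: "'a \<times> 'a"
    have c: "1 - \<tau> * s = c" using \<tau>s by simp
    have "?S (?T (?S z)) = ((1 - \<tau> * s) *\<^sub>R fst z + (\<tau> + \<tau> * (1 - \<tau> * s)) *\<^sub>R snd z,
        (1 - \<tau> * s) *\<^sub>R snd z - s *\<^sub>R fst z)"
      by (simp add: algebra_simps) (simp add: scaleR_left_distrib[symmetric])
    also have "\<tau> + \<tau> * (1 - \<tau> * s) = s" using \<tau>c unfolding \<tau>s by (simp add: distrib_left)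
    finally show "?S (?T (?S z)) = (c *\<^sub>R fst z + s *\<^sub>R snd z, c *\<^sub>R snd z - s *\<^sub>R fst z)"
      by (simp only: c)
  qed
  show ?thesis by (rule subst[where P = "preserves_measure lborel", OF eq pres])
qed

text \<open>If \<open>p\<close> and \<open>x\<close> are independent standard Gaussian vectors, so is \<open>c *\<^sub>R p + s *\<^sub>R x\<close>. It is the first
  component of the rotation of \<open>(p, x)\<close>, under which both Lebesgue measure and the product density
  are invariant; the second component then integrates to 1.\<close>

lemma gaussian_mixture_nn_integral:
  fixes F :: "real ^ 'n::finite \<Rightarrow> ennreal"
  assumes cs: "c\<^sup>2 + s\<^sup>2 = 1" "s \<noteq> 0" and [measurable]: "F \<in> borel_measurable borel"
    and one: "(\<integral>\<^sup>+x. ennreal (std_gaussian_density (x :: real ^ 'n)) \<partial>lborel) = 1"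
  shows "(\<integral>\<^sup>+p. ennreal (std_gaussian_density p) *
        (\<integral>\<^sup>+x. ennreal (std_gaussian_density x) * F (c *\<^sub>R p + s *\<^sub>R x) \<partial>lborel) \<partial>lborel)
    = (\<integral>\<^sup>+p. ennreal (std_gaussian_density p) * F p \<partial>lborel)"
proof -
  let ?E = "\<lambda>x::real^'n. ennreal (std_gaussian_density x)"
  let ?R = "\<lambda>z::(real^'n)\<times>(real^'n). (c *\<^sub>R fst z + s *\<^sub>R snd z, c *\<^sub>R snd z - s *\<^sub>R fst z)"
  let ?G = "\<lambda>z. ?E (fst z) * ?E (snd z) * F (fst z)"
  have EE: "?E p * ?E x = ?E (c *\<^sub>R p + s *\<^sub>R x) * ?E (c *\<^sub>R x - s *\<^sub>R p)" for p x
  proof -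
    have "(norm (c *\<^sub>R p + s *\<^sub>R x))\<^sup>2 + (norm (c *\<^sub>R x - s *\<^sub>R p))\<^sup>2
        = (c\<^sup>2 + s\<^sup>2) * ((norm p)\<^sup>2 + (norm x)\<^sup>2)"
      unfolding power2_norm_eq_inner
      by (simp add: inner_add_left inner_add_right inner_diff_left inner_diff_right
          inner_commute algebra_simps power2_eq_square)
    then have "exp (- (norm p)\<^sup>2 / 2) * exp (- (norm x)\<^sup>2 / 2)
        = exp (- (norm (c *\<^sub>R p + s *\<^sub>R x))\<^sup>2 / 2) * exp (- (norm (c *\<^sub>R x - s *\<^sub>R p))\<^sup>2 / 2)"
      unfolding cs by (simp add: exp_add[symmetric])
    then show ?thesis
      by (simp add: std_gaussian_density_eq ennreal_mult[symmetric])
  qed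
  have Gm [measurable]: "?G \<in> borel_measurable (borel \<Otimes>\<^sub>M borel)" by measurable
  have "(\<integral>\<^sup>+p. ?E p * (\<integral>\<^sup>+x. ?E x * F (c *\<^sub>R p + s *\<^sub>R x) \<partial>lborel) \<partial>lborel)
      = (\<integral>\<^sup>+p. (\<integral>\<^sup>+x. ?G (?R (p, x)) \<partial>lborel) \<partial>lborel)"
    by (simp add: nn_integral_cmult[symmetric] EE[symmetric] mult.assoc)
  also have "\<dots> = (\<integral>\<^sup>+z. ?G (?R z) \<partial>(lborel \<Otimes>\<^sub>M lborel))"
    by (rule lborel.nn_integral_fst) measurable
  also have "\<dots> = (\<integral>\<^sup>+z. ?G z \<partial>(lborel \<Otimes>\<^sub>M lborel))"
    using preserves_measure_nn_integral[OF rotation_preserves_lborel[OF cs], of ?G] Gm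
    by (simp add: lborel_prod borel_prod)
  also have "\<dots> = (\<integral>\<^sup>+p. (\<integral>\<^sup>+x. ?E p * F p * ?E x \<partial>lborel) \<partial>lborel)"
    by (subst lborel.nn_integral_fst[symmetric]) (simp_all add: ac_simps)
  also have "\<dots> = (\<integral>\<^sup>+p. ?E p * F p \<partial>lborel)"
    by (simp add: nn_integral_cmult one)
  finally show ?thesis .
qed

text \<open>Under the Boltzmann--Gibbs measure the momentum is a standard Gaussian vector independent of the
  position.\<close>

lemma BG_measure_nn_integral:
  fixes \<Phi> :: "real ^ 'n::finite \<Rightarrow> real"
  assumes [measurable]: "\<Phi> \<in> borel_measurable borel" "F \<in> borel_measurable borel"
  shows "(\<integral>\<^sup>+z. F z \<partial>BG_measure \<Phi>) =
    (\<integral>\<^sup>+q. ennreal (inverse (\<integral>q. exp (- \<Phi> q) \<partial>lborel) * exp (- \<Phi> q)) *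
      (\<integral>\<^sup>+p. ennreal (std_gaussian_density p) * F (q, p) \<partial>lborel) \<partial>lborel)"
proof -
  have [measurable]: "hamiltonian \<Phi> \<in> borel_measurable borel" by (rule hamiltonian_measurable) fact
  have [measurable]: "F \<in> borel_measurable (borel \<Otimes>\<^sub>M borel)" by (simp add: borel_prod)
  define C where "C = inverse (\<integral>q. exp (- \<Phi> q) \<partial>lborel)"
  have C: "C \<ge> 0" by (simp add: C_def)
  let ?E = "\<lambda>x::real^'n. ennreal (std_gaussian_density x)"
  have w: "ennreal (C * (2 * pi) powr (- real CARD('n) / 2) * exp (- hamiltonian \<Phi> z))
      = ennreal (C * exp (- \<Phi> (fst z))) * ?E (snd z)" for z
    using C by (simp add: ennreal_mult[symmetric] std_gaussian_density_eq hamiltonian_def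
        case_prod_beta exp_add[symmetric] mult.assoc)
  have "(\<integral>\<^sup>+z. F z \<partial>BG_measure \<Phi>) = (\<integral>\<^sup>+z. ennreal (C * exp (- \<Phi> (fst z))) * ?E (snd z) * F z \<partial>lborel)"
    unfolding BG_measure_def Let_def C_def[symmetric] w[symmetric]
    by (rule nn_integral_density) measurable
  also have "\<dots> = (\<integral>\<^sup>+q. ennreal (C * exp (- \<Phi> q)) * (\<integral>\<^sup>+p. ?E p * F (q, p) \<partial>lborel) \<partial>lborel)"
    unfolding lborel_prod[symmetric]
    by (subst lborel.nn_integral_fst[symmetric]) (auto simp: nn_integral_cmult mult.assoc)
  finally show ?thesis by (simp add: C_def)
qed

lemma randomize_preserves_BG_measure:
  fixes \<Phi> :: "real ^ 'n::finite \<Rightarrow> real"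
  assumes [measurable]: "\<Phi> \<in> borel_measurable borel" "F \<in> borel_measurable borel"
    and "sin \<phi> \<noteq> 0"
    and one: "(\<integral>\<^sup>+x. ennreal (std_gaussian_density (x :: real ^ 'n)) \<partial>lborel) = 1"
  shows "(\<integral>\<^sup>+z. (\<integral>\<^sup>+x. ennreal (std_gaussian_density x) * F (randomize \<phi> x z) \<partial>lborel) \<partial>BG_measure \<Phi>)
    = (\<integral>\<^sup>+z. F z \<partial>BG_measure \<Phi>)"
proof -
  have [measurable]: "F \<in> borel_measurable (borel \<Otimes>\<^sub>M borel)" by (simp add: borel_prod)
  let ?I = "\<lambda>z. \<integral>\<^sup>+x. ennreal (std_gaussian_density x) * F (randomize \<phi> x z) \<partial>lborel"
  have "?I \<in> borel_measurable (borel \<Otimes>\<^sub>M borel)"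
    unfolding randomize_def case_prod_beta by measurable
  then have "?I \<in> borel_measurable borel" by (simp add: borel_prod)
  then have "(\<integral>\<^sup>+z. ?I z \<partial>BG_measure \<Phi>) =
    (\<integral>\<^sup>+q. ennreal (inverse (\<integral>q. exp (- \<Phi> q) \<partial>lborel) * exp (- \<Phi> q)) *
      (\<integral>\<^sup>+p. ennreal (std_gaussian_density p) * ?I (q, p) \<partial>lborel) \<partial>lborel)"
    by (rule BG_measure_nn_integral[OF assms(1)])
  also have "\<dots> = (\<integral>\<^sup>+q. ennreal (inverse (\<integral>q. exp (- \<Phi> q) \<partial>lborel) * exp (- \<Phi> q)) *
      (\<integral>\<^sup>+p. ennreal (std_gaussian_density p) * F (q, p) \<partial>lborel) \<partial>lborel)"
    unfolding randomize_def case_prod_conv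
    using assms(3) one
    by (subst gaussian_mixture_nn_integral[of "cos \<phi>" "sin \<phi>" "\<lambda>p. F (q, p)" for q]) auto
  also have "\<dots> = (\<integral>\<^sup>+z. F z \<partial>BG_measure \<Phi>)"
    by (rule BG_measure_nn_integral[OF assms(1,2), symmetric])
  finally show ?thesis .
qed

text \<open>The weight \<open>exp (- \<Phi>)\<close> is at most 1 on the unit ball, since \<open>\<Phi> \<ge> 0\<close>, and is dominated by
  \<open>(norm q)\<^sup>2 * exp (- \<Phi> q)\<close> outside it.\<close>

lemma finite_measure_BG_measure:
  fixes \<Phi> :: "real ^ 'n::finite \<Rightarrow> real"
  assumes [measurable]: "\<Phi> \<in> borel_measurable borel" and nn: "\<And>q. 0 \<le> \<Phi> q"
    and int: "integrable lborel (\<lambda>q. (norm q)\<^sup>2 * exp (- \<Phi> q))"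
    and one: "(\<integral>\<^sup>+x. ennreal (std_gaussian_density (x :: real ^ 'n)) \<partial>lborel) = 1"
  shows "finite_measure (BG_measure \<Phi>)"
proof
  define C where "C = inverse (\<integral>q. exp (- \<Phi> q) \<partial>lborel)"
  have "integrable lborel (\<lambda>q. indicator (cball 0 1) q + (norm q)\<^sup>2 * exp (- \<Phi> q))"
    by (intro Bochner_Integration.integrable_add int integrable_real_indicator)
      (use emeasure_lborel_cball_finite in \<open>auto simp: top.not_eq_extremum\<close>)
  then have "integrable lborel (\<lambda>q. exp (- \<Phi> q))"
  proof (rule Bochner_Integration.integrable_bound)
    show "AE q in lborel. norm (exp (- \<Phi> q)) \<le> norm (indicator (cball 0 1) q + (norm q)\<^sup>2 * exp (- \<Phi> q))"
    proof (intro AE_I2)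
      fix q
      show "norm (exp (- \<Phi> q)) \<le> norm (indicator (cball 0 1) q + (norm q)\<^sup>2 * exp (- \<Phi> q))"
      proof (cases "norm q \<le> 1")
        case True then show ?thesis using nn[of q] by (simp add: add_increasing2)
      next
        case False
        then have "1 * exp (- \<Phi> q) \<le> (norm q)\<^sup>2 * exp (- \<Phi> q)"
          by (intro mult_right_mono) (auto simp: power2_eq_square intro: mult_ge1_I)
        then show ?thesis using False by simp
      qed
    qed
  qed simp
  then have "(\<integral>\<^sup>+q. ennreal (C * exp (- \<Phi> q)) \<partial>lborel) < \<infinity>"
    by (subst nn_integral_eq_integral) (auto simp: C_def)
  moreover have "emeasure (BG_measure \<Phi>) (space (BG_measure \<Phi>)) = (\<integral>\<^sup>+q. ennreal (C * exp (- \<Phi> q)) \<partial>lborel)"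
    using BG_measure_nn_integral[OF assms(1), of "\<lambda>_. 1"] one by (simp add: C_def)
  ultimately show "emeasure (BG_measure \<Phi>) (space (BG_measure \<Phi>)) \<noteq> \<infinity>" by simp
qed

section \<open>Stationarity of a randomized flow\<close>

abbreviation noise_generator ::
    "'w measure \<Rightarrow> (nat \<Rightarrow> 'w \<Rightarrow> real) \<Rightarrow> (nat \<Rightarrow> 'w \<Rightarrow> 'a::euclidean_space) \<Rightarrow> nat + nat \<Rightarrow> 'w set set" where
  "noise_generator M \<delta> \<xi> \<equiv>
     case_sum (\<lambda>n. {\<delta> n -` A \<inter> space M | A. A \<in> sets borel})
              (\<lambda>n. {\<xi> n -` A \<inter> space M | A. A \<in> sets borel})"

text \<open>All waiting times are included, those after jump \<open>n\<close> too: the number of jumps before time \<open>t\<close>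
  is then measurable at every stage, and conditioning on the waiting times is possible although the
  Gaussian vectors are averaged out one by one.\<close>

definition noise_algebra ::
    "'w measure \<Rightarrow> (nat \<Rightarrow> 'w \<Rightarrow> real) \<Rightarrow> (nat \<Rightarrow> 'w \<Rightarrow> 'a::euclidean_space) \<Rightarrow> nat \<Rightarrow> 'w measure" where
  "noise_algebra M \<delta> \<xi> n =
     sigma (space M) (\<Union>i\<in>range Inl \<union> Inr ` {..<n}. noise_generator M \<delta> \<xi> i)"

lemma Int_stable_vimages: "Int_stable {X -` A \<inter> S | A. A \<in> sets N}"
proof (rule Int_stableI)
  fix a b assume "a \<in> {X -` A \<inter> S | A. A \<in> sets N}" "b \<in> {X -` A \<inter> S | A. A \<in> sets N}"
  then obtain A B where "A \<in> sets N" "B \<in> sets N" "a = X -` A \<inter> S" "b = X -` B \<inter> S" by blast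
  then have "a \<inter> b = X -` (A \<inter> B) \<inter> S" "A \<inter> B \<in> sets N" by auto
  then show "a \<inter> b \<in> {X -` A \<inter> S | A. A \<in> sets N}" by blast
qed

text \<open>Momentum randomization with a fixed vector \<open>x\<close> does not preserve \<open>\<mu>\<close>; only its average over the
  Gaussian vector does. This is why its invariance is stated as an iterated integral, unlike that of
  the flow.\<close>

locale stationary_rhmc = prob_space M for M :: "'w measure" +
  fixes \<theta> :: "real \<Rightarrow> 'n::finite phase \<Rightarrow> 'n phase"
    and \<phi> :: real
    and \<delta> :: "nat \<Rightarrow> 'w \<Rightarrow> real"
    and \<xi> :: "nat \<Rightarrow> 'w \<Rightarrow> real ^ 'n"
    and \<mu> :: "'n phase measure"
  assumes finite_\<mu>: "finite_measure \<mu>"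
    and sets_\<mu>: "sets \<mu> = sets borel"
    and flow_pair: "(\<lambda>x. \<theta> (fst x) (snd x)) \<in> borel_measurable (borel \<Otimes>\<^sub>M borel)"
    and flow_invariant: "preserves_measure \<mu> (\<theta> s)"
    and randomize_invariant: "F \<in> borel_measurable borel \<Longrightarrow>
      (\<integral>\<^sup>+z. (\<integral>\<^sup>+x. ennreal (std_gaussian_density x) * F (randomize \<phi> x z) \<partial>lborel) \<partial>\<mu>) = (\<integral>\<^sup>+z. F z \<partial>\<mu>)"
    and gaussian: "distributed M lborel (\<xi> n) std_gaussian_density"
    and independent: "indep_sets (noise_generator M \<delta> \<xi>) UNIV"
begin

interpretation \<mu>: finite_measure \<mu> by (rule finite_\<mu>)

declare sets_\<mu> [measurable_cong, simp]

lemma space_\<mu> [simp]: "space \<mu> = UNIV"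
  using sets_eq_imp_space_eq[OF sets_\<mu>] by simp

lemma flow_measurable [measurable (raw)]:
  assumes [measurable]: "c \<in> borel_measurable N" "y \<in> borel_measurable N"
  shows "(\<lambda>x. \<theta> (c x) (y x)) \<in> borel_measurable N"
  using measurable_compose[OF _ flow_pair, of "\<lambda>x. (c x, y x)" N] by simp

lemma randomize_measurable [measurable (raw)]:
  assumes [measurable]: "x \<in> borel_measurable N" "z \<in> borel_measurable N"
  shows "(\<lambda>u. randomize \<phi> (x u) (z u)) \<in> borel_measurable N"
proof -
  have "(\<lambda>v. randomize \<phi> (fst v) (snd v)) \<in>
      measurable (borel \<Otimes>\<^sub>M (borel \<Otimes>\<^sub>M borel)) (borel \<Otimes>\<^sub>M borel)"
    unfolding randomize_def case_prod_beta by measurable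
  then have "(\<lambda>v. randomize \<phi> (fst v) (snd v)) \<in> borel_measurable (borel \<Otimes>\<^sub>M borel)"
    by (simp add: borel_prod)
  from measurable_compose[OF _ this, of "\<lambda>u. (x u, z u)" N] show ?thesis by simp
qed

abbreviation "\<F> \<equiv> noise_algebra M \<delta> \<xi>"
abbreviation "generator \<equiv> noise_generator M \<delta> \<xi>"

lemma noise_generator_subset: "generator i \<subseteq> Pow (space M)"
  by (auto split: sum.split)

lemma noise_generators_subset: "(\<Union>i\<in>I. generator i) \<subseteq> Pow (space M)"
  using noise_generator_subset by blast

lemma space_noise_algebra [simp]: "space (\<F> n) = space M"
  unfolding noise_algebra_def by (rule space_measure_of[OF noise_generators_subset])

lemma sets_noise_algebra:
  "sets (\<F> n) = sigma_sets (space M) (\<Union>i\<in>range Inl \<union> Inr ` {..<n}. generator i)"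
  unfolding noise_algebra_def by (rule sets_measure_of[OF noise_generators_subset])

lemma sets_noise_algebra_le: "sets (\<F> n) \<subseteq> sets M"
proof -
  have "generator i \<subseteq> sets M" for i using independent unfolding indep_sets_def by auto
  then show ?thesis
    unfolding sets_noise_algebra by (intro sets.sigma_sets_subset) blast
qed

lemma sets_noise_algebra_mono: "m \<le> n \<Longrightarrow> sets (\<F> m) \<subseteq> sets (\<F> n)"
  unfolding sets_noise_algebra by (intro sigma_sets_mono' UN_mono) auto

lemma noise_algebra_measurable_mono: "m \<le> n \<Longrightarrow> f \<in> measurable (\<F> m) N \<Longrightarrow> f \<in> measurable (\<F> n) N"
  using measurable_mono[of N N "\<F> m" "\<F> n"] sets_noise_algebra_mono by auto

lemma noise_algebra_measurable: "f \<in> measurable (\<F> n) N \<Longrightarrow> f \<in> measurable M N"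
  using measurable_mono[of N N "\<F> n" M] sets_noise_algebra_le by auto

lemma waiting_time_measurable [measurable]: "\<delta> i \<in> borel_measurable (\<F> n)"
proof (rule measurableI)
  fix A :: "real set" assume "A \<in> sets borel"
  then have "\<delta> i -` A \<inter> space M \<in> generator (Inl i)" by auto
  then show "\<delta> i -` A \<inter> space (\<F> n) \<in> sets (\<F> n)"
    unfolding sets_noise_algebra space_noise_algebra by (intro sigma_sets.Basic) blast
qed simp

lemma gaussian_vector_measurable: "i < n \<Longrightarrow> \<xi> i \<in> borel_measurable (\<F> n)"
proof (rule measurableI)
  fix A :: "(real ^ 'n) set" assume "i < n" "A \<in> sets borel"
  then have "\<xi> i -` A \<inter> space M \<in> generator (Inr i)" by auto
  then show "\<xi> i -` A \<inter> space (\<F> n) \<in> sets (\<F> n)"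
    unfolding sets_noise_algebra space_noise_algebra
    using \<open>i < n\<close> by (intro sigma_sets.Basic) blast
qed simp

text \<open>Mutual independence passes to the \<open>\<sigma>\<close>-algebras generated by disjoint groups of variables.\<close>

lemma next_gaussian_indep_past:
  assumes A: "A \<in> sets (\<F> n)" and B: "B \<in> sets borel"
  shows "prob (A \<inter> (\<xi> n -` B \<inter> space M)) = prob A * prob (\<xi> n -` B \<inter> space M)"
proof -
  let ?I = "case_bool (range Inl \<union> Inr ` {..<n}) {Inr n}"
  have indep: "indep_sets (\<lambda>j. sigma_sets (space M) (\<Union>i\<in>?I j. generator i)) UNIV"
  proof (rule indep_sets_collect_sigma)
    show "indep_sets generator (\<Union>j\<in>UNIV. ?I j)"
      by (rule indep_sets_mono_index[OF subset_UNIV independent])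
    show "disjoint_family_on ?I UNIV"
      by (auto simp: disjoint_family_on_def split: bool.splits)
    fix i :: "nat + nat"
    show "Int_stable (generator i)" by (cases i) (simp_all add: Int_stable_vimages)
  qed
  have "\<xi> n -` B \<inter> space M \<in> generator (Inr n)" using B by auto
  then have "\<forall>j. case_bool A (\<xi> n -` B \<inter> space M) j \<in> sigma_sets (space M) (\<Union>i\<in>?I j. generator i)"
    using A unfolding sets_noise_algebra by (auto split: bool.split)
  then show ?thesis
    using indep_setsD[OF indep, of UNIV "case_bool A (\<xi> n -` B \<inter> space M)"]
    by (simp add: UNIV_bool Int_commute mult.commute)
qed

text \<open>The vector \<open>\<xi> n\<close> can be integrated out against its density, with everything in the past frozen. The
  joint law to which Fubini applies is that of the pair \<open>(\<omega>, \<xi> n \<omega>)\<close>, with the sample point itself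
  as first component, observed only through the past.\<close>

lemma nn_integral_next_gaussian:
  assumes F [measurable]: "F \<in> borel_measurable (\<F> n \<Otimes>\<^sub>M borel)"
  shows "(\<integral>\<^sup>+\<omega>. F (\<omega>, \<xi> n \<omega>) \<partial>M)
    = (\<integral>\<^sup>+\<omega>. (\<integral>\<^sup>+x. ennreal (std_gaussian_density x) * F (\<omega>, x) \<partial>lborel) \<partial>M)"
proof -
  have rv: "random_variable (\<F> n) (\<lambda>\<omega>. \<omega>)" "random_variable lborel (\<xi> n)"
    using noise_algebra_measurable[where f = "\<lambda>\<omega>. \<omega>" and n = n and N = "\<F> n"] distributed_measurable[OF gaussian] by auto
  interpret X: prob_space "distr M lborel (\<xi> n)" by (rule prob_space_distr) fact
  interpret Y: prob_space "distr M (\<F> n) (\<lambda>\<omega>. \<omega>)" by (rule prob_space_distr) fact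
  have joint: "distr M (\<F> n) (\<lambda>\<omega>. \<omega>) \<Otimes>\<^sub>M distr M lborel (\<xi> n)
      = distr M (\<F> n \<Otimes>\<^sub>M lborel) (\<lambda>\<omega>. (\<omega>, \<xi> n \<omega>))"
  proof (rule pair_measure_eqI)
    fix A B assume "A \<in> sets (distr M (\<F> n) (\<lambda>\<omega>. \<omega>))" "B \<in> sets (distr M lborel (\<xi> n))"
    then have A: "A \<in> sets (\<F> n)" and B: "B \<in> sets borel" by auto
    then have AB: "A \<times> B \<in> sets (\<F> n \<Otimes>\<^sub>M lborel)" by auto
    have "A \<subseteq> space M" using sets.sets_into_space[OF A] by simp
    then have "(\<lambda>\<omega>. \<omega>) -` A \<inter> space M = A"
      "(\<lambda>\<omega>. (\<omega>, \<xi> n \<omega>)) -` (A \<times> B) \<inter> space M = A \<inter> (\<xi> n -` B \<inter> space M)" by auto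
    with next_gaussian_indep_past[OF A B] A B AB rv
    show "emeasure (distr M (\<F> n) (\<lambda>\<omega>. \<omega>)) A * emeasure (distr M lborel (\<xi> n)) B
        = emeasure (distr M (\<F> n \<Otimes>\<^sub>M lborel) (\<lambda>\<omega>. (\<omega>, \<xi> n \<omega>))) (A \<times> B)"
      by (simp add: emeasure_distr measurable_Pair emeasure_eq_measure ennreal_mult[symmetric])
  qed (simp_all add: X.sigma_finite_measure Y.sigma_finite_measure)
  have Fm: "F \<in> borel_measurable (\<F> n \<Otimes>\<^sub>M lborel)"
    using F by (simp cong: measurable_cong_sets)
  have "(\<integral>\<^sup>+\<omega>. F (\<omega>, \<xi> n \<omega>) \<partial>M) = (\<integral>\<^sup>+v. F v \<partial>distr M (\<F> n \<Otimes>\<^sub>M lborel) (\<lambda>\<omega>. (\<omega>, \<xi> n \<omega>)))"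
    by (rule nn_integral_distr[symmetric]) (use rv Fm in \<open>auto intro: measurable_Pair\<close>)
  also have "\<dots> = (\<integral>\<^sup>+\<omega>. (\<integral>\<^sup>+x. F (\<omega>, x) \<partial>distr M lborel (\<xi> n)) \<partial>distr M (\<F> n) (\<lambda>\<omega>. \<omega>))"
    unfolding joint[symmetric] by (rule X.nn_integral_fst[symmetric])
      (use Fm in \<open>simp cong: measurable_cong_sets\<close>)
  also have "\<dots> = (\<integral>\<^sup>+\<omega>. (\<integral>\<^sup>+x. ennreal (std_gaussian_density x) * F (\<omega>, x) \<partial>lborel) \<partial>distr M (\<F> n) (\<lambda>\<omega>. \<omega>))"
    unfolding distributed_distr_eq_density[OF gaussian]
    by (intro nn_integral_cong, subst nn_integral_density) auto
  also have "\<dots> = (\<integral>\<^sup>+\<omega>. (\<integral>\<^sup>+x. ennreal (std_gaussian_density x) * F (\<omega>, x) \<partial>lborel) \<partial>M)"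
    by (rule nn_integral_distr[OF rv(1)]) measurable
  finally show ?thesis .
qed

abbreviation "Z n z \<omega> \<equiv> rhmc_at_jump \<theta> \<phi> \<delta> \<xi> z n \<omega>"

lemma rhmc_at_jump_measurable:
  "(\<lambda>v. Z n (snd v) (fst v)) \<in> borel_measurable (\<F> n \<Otimes>\<^sub>M borel)"
proof (induction n)
  case 0 then show ?case by simp
next
  case (Suc n)
  have id: "(\<lambda>\<omega>. \<omega>) \<in> measurable (\<F> (Suc n)) (\<F> n)"
    by (rule noise_algebra_measurable_mono[where m = n]) auto
  have "(\<lambda>v. (fst v, snd v)) \<in> measurable (\<F> (Suc n) \<Otimes>\<^sub>M borel) (\<F> n \<Otimes>\<^sub>M (borel :: 'n phase measure))"
    by (intro measurable_Pair measurable_compose[OF measurable_fst id] measurable_snd)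
  from measurable_compose[OF this Suc]
  have [measurable]: "(\<lambda>v. Z n (snd v) (fst v)) \<in> borel_measurable (\<F> (Suc n) \<Otimes>\<^sub>M borel)" by simp
  have [measurable]: "\<xi> n \<in> borel_measurable (\<F> (Suc n))" by (rule gaussian_vector_measurable) simp
  show ?case by simp
qed

lemma rhmc_at_jump_measurable_raw [measurable (raw)]:
  assumes [measurable]: "f \<in> measurable N (\<F> n)" "y \<in> borel_measurable N"
  shows "(\<lambda>u. Z n (y u) (f u)) \<in> borel_measurable N"
  using measurable_compose[OF _ rhmc_at_jump_measurable, of "\<lambda>u. (f u, y u)" N n] by simp

text \<open>The state after \<open>n\<close> jumps, started from \<open>\<mu>\<close>, has law \<open>\<mu>\<close> and is independent of all waiting times:
  \<open>G\<close> may depend on the latter through its first argument. In the induction step, averaging over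
  \<open>\<xi> n\<close> turns \<open>G\<close> into a test function of the state after \<open>n\<close> jumps that again depends on \<open>\<omega>\<close> only
  through the waiting times, so that the induction hypothesis applies; the invariance of \<open>\<mu>\<close> under
  the flow for the fixed time \<open>\<delta> n \<omega>\<close> and under momentum randomization then removes both operations.\<close>

lemma rhmc_at_jump_stationary:
  assumes "G \<in> borel_measurable (\<F> 0 \<Otimes>\<^sub>M borel)"
  shows "(\<integral>\<^sup>+\<omega>. (\<integral>\<^sup>+z. G (\<omega>, Z n z \<omega>) \<partial>\<mu>) \<partial>M) = (\<integral>\<^sup>+\<omega>. (\<integral>\<^sup>+z. G (\<omega>, z) \<partial>\<mu>) \<partial>M)"
  using assms
proof (induction n arbitrary: G)
  case 0 then show ?case by simp
next
  case (Suc n)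
  note G0 = Suc.prems
  have id: "(\<lambda>\<omega>. \<omega>) \<in> measurable (\<F> n) (\<F> 0)"
    by (rule noise_algebra_measurable_mono[where m = 0]) auto
  have "(\<lambda>v. (fst v, snd v)) \<in> measurable (\<F> n \<Otimes>\<^sub>M borel) (\<F> 0 \<Otimes>\<^sub>M (borel :: 'n phase measure))"
    by (intro measurable_Pair measurable_compose[OF measurable_fst id] measurable_snd)
  from measurable_compose[OF this G0]
  have Gn: "G \<in> borel_measurable (\<F> n \<Otimes>\<^sub>M borel)" by simp
  interpret P: pair_sigma_finite lborel \<mu> by unfold_locales
  let ?\<gamma> = "\<lambda>x::real^'n. ennreal (std_gaussian_density x)"
  let ?F = "\<lambda>v. \<integral>\<^sup>+z. G (fst v, randomize \<phi> (snd v) (\<theta> (\<delta> n (fst v)) (Z n z (fst v)))) \<partial>\<mu>"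
  let ?H = "\<lambda>v. \<integral>\<^sup>+x. ?\<gamma> x * G (fst v, randomize \<phi> x (snd v)) \<partial>lborel"
  let ?G = "\<lambda>v. ?H (fst v, \<theta> (\<delta> n (fst v)) (snd v))"
  have F: "?F \<in> borel_measurable (\<F> n \<Otimes>\<^sub>M borel)"
  proof -
    note [measurable] = Gn
    show ?thesis by measurable
  qed
  note G0 [measurable]
  have H [measurable]: "?H \<in> borel_measurable (\<F> 0 \<Otimes>\<^sub>M borel)" by measurable
  have G': "?G \<in> borel_measurable (\<F> 0 \<Otimes>\<^sub>M borel)" by measurable
  have "(\<integral>\<^sup>+\<omega>. (\<integral>\<^sup>+z. G (\<omega>, Z (Suc n) z \<omega>) \<partial>\<mu>) \<partial>M) = (\<integral>\<^sup>+\<omega>. ?F (\<omega>, \<xi> n \<omega>) \<partial>M)"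
    by simp
  also have "\<dots> = (\<integral>\<^sup>+\<omega>. (\<integral>\<^sup>+x. ?\<gamma> x * ?F (\<omega>, x) \<partial>lborel) \<partial>M)"
    by (rule nn_integral_next_gaussian[OF F])
  also have "\<dots> = (\<integral>\<^sup>+\<omega>. (\<integral>\<^sup>+z. ?G (\<omega>, Z n z \<omega>) \<partial>\<mu>) \<partial>M)"
  proof (rule nn_integral_cong)
    fix \<omega> assume "\<omega> \<in> space M"
    then have [measurable]: "(\<lambda>z. Z n z \<omega>) \<in> borel_measurable borel"
      "(\<lambda>z. G (\<omega>, z)) \<in> borel_measurable borel"
      using measurable_compose[OF measurable_Pair1' rhmc_at_jump_measurable[of n], of \<omega>]
        measurable_compose[OF measurable_Pair1' G0, of \<omega>] by simp_all
    have "(\<integral>\<^sup>+x. ?\<gamma> x * ?F (\<omega>, x) \<partial>lborel) =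
       (\<integral>\<^sup>+x. (\<integral>\<^sup>+z. ?\<gamma> x * G (\<omega>, randomize \<phi> x (\<theta> (\<delta> n \<omega>) (Z n z \<omega>))) \<partial>\<mu>) \<partial>lborel)"
      by (simp add: nn_integral_cmult)
    also have "\<dots> = (\<integral>\<^sup>+z. (\<integral>\<^sup>+x. ?\<gamma> x * G (\<omega>, randomize \<phi> x (\<theta> (\<delta> n \<omega>) (Z n z \<omega>))) \<partial>lborel) \<partial>\<mu>)"
      by (rule P.Fubini'[symmetric]) measurable
    finally show "(\<integral>\<^sup>+x. ?\<gamma> x * ?F (\<omega>, x) \<partial>lborel) = (\<integral>\<^sup>+z. ?G (\<omega>, Z n z \<omega>) \<partial>\<mu>)" by simp
  qed
  also have "\<dots> = (\<integral>\<^sup>+\<omega>. (\<integral>\<^sup>+z. ?G (\<omega>, z) \<partial>\<mu>) \<partial>M)" by (rule Suc.IH[OF G'])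
  also have "\<dots> = (\<integral>\<^sup>+\<omega>. (\<integral>\<^sup>+z. G (\<omega>, z) \<partial>\<mu>) \<partial>M)"
  proof (rule nn_integral_cong)
    fix \<omega> assume "\<omega> \<in> space M"
    then have [measurable]: "(\<lambda>z. ?H (\<omega>, z)) \<in> borel_measurable borel"
      "(\<lambda>z. G (\<omega>, z)) \<in> borel_measurable borel"
      using measurable_compose[OF measurable_Pair1' H, of \<omega>]
        measurable_compose[OF measurable_Pair1' G0, of \<omega>] by simp_all
    have "(\<integral>\<^sup>+z. ?G (\<omega>, z) \<partial>\<mu>) = (\<integral>\<^sup>+z. ?H (\<omega>, z) \<partial>\<mu>)"
      using preserves_measure_nn_integral[OF flow_invariant, of "\<lambda>z. ?H (\<omega>, z)" "\<delta> n \<omega>"] by simp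
    also have "\<dots> = (\<integral>\<^sup>+z. G (\<omega>, z) \<partial>\<mu>)"
      using randomize_invariant[of "\<lambda>z. G (\<omega>, z)"] by simp
    finally show "(\<integral>\<^sup>+z. ?G (\<omega>, z) \<partial>\<mu>) = (\<integral>\<^sup>+z. G (\<omega>, z) \<partial>\<mu>)" .
  qed
  finally show ?case .
qed

definition jump_index :: "real \<Rightarrow> 'w \<Rightarrow> nat" where
  "jump_index t \<omega> = (LEAST n. jump_time \<delta> n \<omega> \<le> t \<and> t < jump_time \<delta> (Suc n) \<omega>)"

lemma jump_time_measurable [measurable]: "jump_time \<delta> n \<in> borel_measurable (\<F> k)"
  unfolding jump_time_def by measurable

lemma jump_index_measurable [measurable]: "jump_index t \<in> measurable (\<F> k) (count_space UNIV)"
  unfolding jump_index_def[abs_def] by measurable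

lemma rhmc_eq: "rhmc \<theta> \<phi> \<delta> \<xi> z t \<omega>
    = \<theta> (t - jump_time \<delta> (jump_index t \<omega>) \<omega>) (Z (jump_index t \<omega>) z \<omega>)"
  by (simp add: rhmc_def jump_index_def Let_def)

lemma rhmc_measurable: "(\<lambda>v. rhmc \<theta> \<phi> \<delta> \<xi> (fst v) t (snd v)) \<in> borel_measurable (\<mu> \<Otimes>\<^sub>M M)"
proof -
  have "(\<lambda>v. \<theta> (t - jump_time \<delta> k (snd v)) (Z k (fst v) (snd v))) \<in> borel_measurable (\<mu> \<Otimes>\<^sub>M M)" for k
  proof -
    have "(\<lambda>v. (snd v, fst v)) \<in> measurable (\<mu> \<Otimes>\<^sub>M M) (\<F> k \<Otimes>\<^sub>M borel)"
      using noise_algebra_measurable[where f = "\<lambda>\<omega>. \<omega>" and n = k and N = "\<F> k"]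
      by (intro measurable_Pair measurable_compose[OF measurable_snd, of "\<lambda>\<omega>. \<omega>"]) auto
    from measurable_compose[OF this rhmc_at_jump_measurable]
    have [measurable]: "(\<lambda>v. Z k (fst v) (snd v)) \<in> borel_measurable (\<mu> \<Otimes>\<^sub>M M)" by simp
    have [measurable]: "jump_time \<delta> k \<in> borel_measurable M"
      by (rule noise_algebra_measurable[OF jump_time_measurable])
    show ?thesis by measurable
  qed
  moreover have "(\<lambda>v. jump_index t (snd v)) \<in> measurable (\<mu> \<Otimes>\<^sub>M M) (count_space UNIV)"
    using noise_algebra_measurable[OF jump_index_measurable] by measurable
  ultimately show ?thesis
    unfolding rhmc_eq by (rule measurable_compose_countable)
qed

text \<open>Summing over the value \<open>n\<close> of the jump index reduces the claim to the state after \<open>n\<close> jumps,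
  followed by the flow for a time that depends on the waiting times only. Where no
  index satisfies the defining condition, \<open>LEAST\<close> returns a fixed number, so the jump index is a
  measurable function of the waiting times there as well.\<close>

lemma rhmc_stationary_nn_integral:
  assumes B [measurable]: "B \<in> sets borel"
  shows "(\<integral>\<^sup>+\<omega>. (\<integral>\<^sup>+z. indicator B (rhmc \<theta> \<phi> \<delta> \<xi> z t \<omega>) \<partial>\<mu>) \<partial>M) = emeasure \<mu> B"
proof -
  let ?G = "\<lambda>n v. if n = jump_index t (fst v)
      then indicator B (\<theta> (t - jump_time \<delta> n (fst v)) (snd v)) else (0 :: ennreal)"
  have G [measurable]: "?G n \<in> borel_measurable (\<F> k \<Otimes>\<^sub>M borel)" for n k by measurable
  have [measurable]: "jump_index t \<in> measurable M (count_space UNIV)"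
    by (rule noise_algebra_measurable[OF jump_index_measurable])
  have single: "(\<Sum>n. if n = k then f n else 0) = f k" for k :: nat and f :: "nat \<Rightarrow> ennreal"
    using sums_unique[OF sums_single[of k f]] by simp
  have GZ: "(\<lambda>v. ?G n (fst v, Z n (snd v) (fst v))) \<in> borel_measurable (\<F> n \<Otimes>\<^sub>M borel)" for n
    by measurable
  have "(\<integral>\<^sup>+\<omega>. (\<integral>\<^sup>+z. indicator B (rhmc \<theta> \<phi> \<delta> \<xi> z t \<omega>) \<partial>\<mu>) \<partial>M)
      = (\<integral>\<^sup>+\<omega>. (\<integral>\<^sup>+z. (\<Sum>n. ?G n (\<omega>, Z n z \<omega>)) \<partial>\<mu>) \<partial>M)"
    by (simp add: single rhmc_eq)
  also have "\<dots> = (\<integral>\<^sup>+\<omega>. (\<Sum>n. \<integral>\<^sup>+z. ?G n (\<omega>, Z n z \<omega>) \<partial>\<mu>) \<partial>M)"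
  proof (intro nn_integral_cong nn_integral_suminf)
    fix \<omega> n assume "\<omega> \<in> space M"
    then show "(\<lambda>z. ?G n (\<omega>, Z n z \<omega>)) \<in> borel_measurable \<mu>"
      using measurable_compose[OF measurable_Pair1' GZ, of \<omega>] by simp
  qed
  also have "\<dots> = (\<Sum>n. \<integral>\<^sup>+\<omega>. (\<integral>\<^sup>+z. ?G n (\<omega>, Z n z \<omega>) \<partial>\<mu>) \<partial>M)"
  proof (rule nn_integral_suminf)
    fix n
    have "(\<lambda>v. ?G n (fst v, Z n (snd v) (fst v))) \<in> borel_measurable (\<F> n \<Otimes>\<^sub>M \<mu>)"
      using GZ[of n] by (simp cong: measurable_cong_sets)
    from \<mu>.borel_measurable_nn_integral_fst[OF this]
    show "(\<lambda>\<omega>. \<integral>\<^sup>+z. ?G n (\<omega>, Z n z \<omega>) \<partial>\<mu>) \<in> borel_measurable M"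
      by (intro noise_algebra_measurable[where n = n]) simp
  qed
  also have "\<dots> = (\<Sum>n. \<integral>\<^sup>+\<omega>. (\<integral>\<^sup>+z. ?G n (\<omega>, z) \<partial>\<mu>) \<partial>M)"
    by (intro suminf_cong rhmc_at_jump_stationary G)
  also have "\<dots> = (\<Sum>n. \<integral>\<^sup>+\<omega>. (if n = jump_index t \<omega> then emeasure \<mu> B else 0) \<partial>M)"
  proof (intro suminf_cong nn_integral_cong)
    fix n \<omega>
    have "(\<integral>\<^sup>+z. indicator B (\<theta> s z) \<partial>\<mu>) = emeasure \<mu> B" for s
      using preserves_measure_nn_integral[OF flow_invariant, of "indicator B"] by simp
    then show "(\<integral>\<^sup>+z. ?G n (\<omega>, z) \<partial>\<mu>) = (if n = jump_index t \<omega> then emeasure \<mu> B else 0)"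
      by simp
  qed
  also have "\<dots> = (\<integral>\<^sup>+\<omega>. (\<Sum>n. (if n = jump_index t \<omega> then emeasure \<mu> B else 0)) \<partial>M)"
    by (rule nn_integral_suminf[symmetric]) measurable
  also have "\<dots> = emeasure \<mu> B" unfolding single by (simp add: emeasure_space_1)
  finally show ?thesis .
qed

lemma rhmc_stationary_distr:
  "distr (\<mu> \<Otimes>\<^sub>M M) borel (\<lambda>v. rhmc \<theta> \<phi> \<delta> \<xi> (fst v) t (snd v)) = \<mu>"
proof (rule measure_eqI)
  interpret P: pair_sigma_finite \<mu> M by unfold_locales
  fix B assume "B \<in> sets (distr (\<mu> \<Otimes>\<^sub>M M) borel (\<lambda>v. rhmc \<theta> \<phi> \<delta> \<xi> (fst v) t (snd v)))"
  then have [measurable]: "B \<in> sets borel" by simp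
  note [measurable] = rhmc_measurable
  have "emeasure (distr (\<mu> \<Otimes>\<^sub>M M) borel (\<lambda>v. rhmc \<theta> \<phi> \<delta> \<xi> (fst v) t (snd v))) B
      = (\<integral>\<^sup>+v. indicator B v \<partial>distr (\<mu> \<Otimes>\<^sub>M M) borel (\<lambda>v. rhmc \<theta> \<phi> \<delta> \<xi> (fst v) t (snd v)))"
    by simp
  also have "\<dots> = (\<integral>\<^sup>+v. indicator B (rhmc \<theta> \<phi> \<delta> \<xi> (fst v) t (snd v)) \<partial>(\<mu> \<Otimes>\<^sub>M M))"
    by (rule nn_integral_distr) measurable
  also have "\<dots> = (\<integral>\<^sup>+\<omega>. (\<integral>\<^sup>+z. indicator B (rhmc \<theta> \<phi> \<delta> \<xi> z t \<omega>) \<partial>\<mu>) \<partial>M)"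
    by (subst P.nn_integral_snd[symmetric]) simp_all
  also have "\<dots> = emeasure \<mu> B" by (rule rhmc_stationary_nn_integral) measurable
  finally show "emeasure (distr (\<mu> \<Otimes>\<^sub>M M) borel (\<lambda>v. rhmc \<theta> \<phi> \<delta> \<xi> (fst v) t (snd v))) B
      = emeasure \<mu> B" .
qed simp

theorem rhmc_stationary_integral:
  fixes f :: "'n phase \<Rightarrow> real"
  assumes [measurable]: "f \<in> borel_measurable borel" and bdd: "\<And>z. \<bar>f z\<bar> \<le> B"
  shows "(\<integral>z. (\<integral>\<omega>. f (rhmc \<theta> \<phi> \<delta> \<xi> z t \<omega>) \<partial>M) \<partial>\<mu>) = (\<integral>z. f z \<partial>\<mu>)"
proof -
  interpret P: pair_sigma_finite \<mu> M by unfold_locales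
  interpret F: finite_measure "\<mu> \<Otimes>\<^sub>M M"
    by (rule finite_measure_pair_measure) unfold_locales
  note [measurable] = rhmc_measurable
  have "integrable (\<mu> \<Otimes>\<^sub>M M) (\<lambda>v. f (rhmc \<theta> \<phi> \<delta> \<xi> (fst v) t (snd v)))"
    by (rule F.integrable_const_bound[of _ B]) (use bdd in auto)
  then have "(\<integral>z. (\<integral>\<omega>. f (rhmc \<theta> \<phi> \<delta> \<xi> z t \<omega>) \<partial>M) \<partial>\<mu>)
      = (\<integral>v. f (rhmc \<theta> \<phi> \<delta> \<xi> (fst v) t (snd v)) \<partial>(\<mu> \<Otimes>\<^sub>M M))"
    using P.integral_fst'[of "\<lambda>v. f (rhmc \<theta> \<phi> \<delta> \<xi> (fst v) t (snd v))"] by simp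
  also have "\<dots> = (\<integral>z. f z \<partial>distr (\<mu> \<Otimes>\<^sub>M M) borel (\<lambda>v. rhmc \<theta> \<phi> \<delta> \<xi> (fst v) t (snd v)))"
    by (rule integral_distr[symmetric]) measurable
  finally show ?thesis unfolding rhmc_stationary_distr .
qed

end

lemma test_function_continuous: "test_function f \<Longrightarrow> continuous_on UNIV f"
  unfolding test_function_def by (metis C_k.simps(1))

lemma test_function_bounded:
  assumes f: "test_function f" shows "\<exists>B. \<forall>z. \<bar>f z\<bar> \<le> B"
proof -
  have "compact (f ` closure {x. f x \<noteq> 0})"
  proof (rule compact_continuous_image)
    show "continuous_on (closure {x. f x \<noteq> 0}) f"
      by (rule continuous_on_subset[OF test_function_continuous[OF f] subset_UNIV])
    show "compact (closure {x. f x \<noteq> 0})" using f unfolding test_function_def by (rule conjunct2)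
  qed
  then obtain B where B: "\<forall>y\<in>f ` closure {x. f x \<noteq> 0}. norm y \<le> B"
    using compact_imp_bounded[of "f ` closure {x. f x \<noteq> 0}"] unfolding bounded_iff by iprover
  have "\<bar>f z\<bar> \<le> max B 0" for z
  proof (cases "f z = 0")
    case False
    then have "z \<in> closure {x. f x \<noteq> 0}"
      using subsetD[OF closure_subset, of z "{x. f x \<noteq> 0}"] by simp
    then have "norm (f z) \<le> B" using B by blast
    then show ?thesis by simp
  qed simp
  then show ?thesis by blast
qed

section \<open>Stationarity of the Boltzmann--Gibbs measure\<close>

lemma distributed_lborel_nn_integral_eq_1:
  assumes "prob_space M" "distributed M lborel X f"
  shows "(\<integral>\<^sup>+x. f x \<partial>lborel) = 1"
proof -
  interpret prob_space M by fact
  have X: "X \<in> measurable M lborel" using distributed_measurable[OF assms(2)] .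
  have "(\<integral>\<^sup>+x. f x \<partial>lborel) = emeasure (density lborel f) (space lborel)"
    using distributed_borel_measurable[OF assms(2)] by (simp add: emeasure_density)
  also have "\<dots> = emeasure (distr M lborel X) (space (distr M lborel X))"
    by (simp add: distributed_distr_eq_density[OF assms(2)])
  also have "\<dots> = 1" by (rule prob_space.emeasure_space_1[OF prob_space_distr[OF X]])
  finally show ?thesis .
qed

theorem lemma3p6:
  fixes \<Phi> :: "real ^ 'n::finite \<Rightarrow> real"
    and lam \<phi> c1 c2 t :: real
    and \<theta> :: "real \<Rightarrow> 'n phase \<Rightarrow> 'n phase"
    and M :: "'w measure"
    and \<delta> :: "nat \<Rightarrow> 'w \<Rightarrow> real"
    and \<xi> :: "nat \<Rightarrow> 'w \<Rightarrow> real ^ 'n"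
    and f :: "'n phase \<Rightarrow> real"
  assumes "lam > 0"
    and "\<phi> \<in> {0<..pi / 2}"
    and "c1 = inverse lam / 4 * (sin \<phi>)\<^sup>2"
    and "c2 = inverse lam * c1 * (1 - cos \<phi>)"
    and "C_k 2 \<Phi>"
    and "\<And>q. \<Phi> q \<ge> 0"
    and "integrable lborel (\<lambda>q. (norm q)\<^sup>2 * exp (- \<Phi> q))"
    and "\<exists>a>0. \<exists>b\<in>{0<..<1}. \<forall>q.
           1 / 2 * (gradient \<Phi> q \<bullet> q)
             \<ge> b * \<Phi> q + ((c1 * b)\<^sup>2 + c2 * b * (1 - b)) / (2 * (1 - b)) * (norm q)\<^sup>2 - a"
    and "hamiltonian_flow \<Phi> \<theta>"
    and "rhmc_noise M lam \<delta> \<xi>"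
    and "test_function f"
    and "t > 0"
  shows "(\<integral>z. (\<integral>\<omega>. f (rhmc \<theta> \<phi> \<delta> \<xi> z t \<omega>) \<partial>M) \<partial>BG_measure \<Phi>) = (\<integral>z. f z \<partial>BG_measure \<Phi>)"
proof -
  have C2: "C_k 2 \<Phi>" and flow: "hamiltonian_flow \<Phi> \<theta>" and noise: "rhmc_noise M lam \<delta> \<xi>"
    and f: "test_function f"
    using assms by blast+
  have prob: "prob_space M" and gaussian: "\<And>n. distributed M lborel (\<xi> n) std_gaussian_density"
    and indep: "prob_space.indep_sets M (noise_generator M \<delta> \<xi>) UNIV"
    using noise unfolding rhmc_noise_def by auto
  have one: "(\<integral>\<^sup>+x. ennreal (std_gaussian_density (x :: real ^ 'n)) \<partial>lborel) = 1"
    by (rule distributed_lborel_nn_integral_eq_1[OF prob gaussian])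
  have \<Phi>_measurable: "\<Phi> \<in> borel_measurable borel"
    by (rule borel_measurable_continuous_onI[OF potential_continuous[OF C2]])
  have "sin \<phi> > 0" using assms(2) by (intro sin_gt_zero) auto
  then have sin: "sin \<phi> \<noteq> 0" by simp
  interpret newton_flow "gradient \<Phi>" \<theta> by (rule hamiltonian_flow_newton_flow[OF C2 flow])
  have "stationary_rhmc M \<theta> \<phi> \<delta> \<xi> (BG_measure \<Phi>)"
    unfolding stationary_rhmc_def stationary_rhmc_axioms_def
    using prob gaussian indep flow_measurable_pair flow_preserves_BG_measure[OF C2 flow]
      finite_measure_BG_measure[OF \<Phi>_measurable assms(6,7) one]
      randomize_preserves_BG_measure[OF \<Phi>_measurable _ sin one]
    by (intro conjI) auto
  then interpret stationary_rhmc M \<theta> \<phi> \<delta> \<xi> "BG_measure \<Phi>" .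
  obtain B where "\<forall>z. \<bar>f z\<bar> \<le> B" using test_function_bounded[OF f] by blast
  then show ?thesis
    using borel_measurable_continuous_onI[OF test_function_continuous[OF f]]
    by (intro rhmc_stationary_integral[of f B]) auto
qed

end
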